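(* Let $V_{\mathrm{reg}} = H^2(\Omega)$ and, with $a$, $N^c$, $\mathcal{L}$ and $V_h$ as defined in the context, consider the bilinear form $$A^{nn}(u,v) := a(u,v) + N^c(u,v) + N^c(v,u) + 2\,a(\mathcal{L}(u),\mathcal{L}(v)), \qquad u,v \in V_{\mathrm{reg}} + V_h.$$ Then $A^{nn}$ is non-negative in $V_h$ (that is, $A^{nn}(u_h,u_h)\ge 0$ for all $u_h\in V_h$), and $$A^{nn}(u_h,u_h) \;\ge\; \tfrac12\, a(u_h,u_h) \qquad \text{for all } u_h \in V_h.$$
   Context: Let $\Omega \subset \mathbb{R}^d$ be a bounded polyhedral domain with a shape-regular, quasi-uniform simplicial triangulation $\mathcal{T}_h$ of characteristic mesh size $h>0$ that is fitted to the boundary (the elements exactly triangulate $\Omega$). Let $k\ge 1$ be an integer. $\mathcal{P}^k(T)$ denotes the polynomials of degree at most $k$ on $T$. For a set $S$, $(u,v)_S=\int_S u\,v\,ds$ (with the dot product for vector-valued functions). $V_h\subset H^1(\Omega)$ is the finite element space of all continuous functions on $\overline\Omega$ whose restriction to each $T\in\mathcal{T}_h$ belongs to $\mathcal{P}^k(T)$ (no boundary condition is imposed). $\partial_n$ is the outward normal derivative on $\partial\Omega$. Bilinear forms: - $a(u,v)=\sum_{T\in\mathcal{T}_h} a_T(u,v)$ with $a_T(u,v)=(\nabla u,\nabla v)_T$. The gradient is taken elementwise ("broken"), so $a$ is defined for elementwise $H^1$ functions. - $N^c(u,v)=\sum_{T\in\mathcal{T}_h} N^c_T(u,v)$ with $N^c_T(u,v)=(-\partial_n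 u, v)_{\partial\Omega\cap \partial T}$, so that $N^c(u,v)=(-\partial_n u,v)_{\partial\Omega}$. Lifting operator: let $\mathcal{P}^k_0(T)$ be the space of polynomials in $\mathcal{P}^k(T)$ that are $L^2(T)$-orthogonal to constants. For an element $T$ located at the boundary (i.e. $\partial T\cap\partial\Omega$ has positive $(d-1)$-dimensional measure), $\mathcal{L}_T:H^1(T)\to\mathcal{P}^k_0(T)$ is defined by $$a_T(\mathcal{L}_T(u),v)=N^c_T(v,u)\qquad \text{for all } v\in\mathcal{P}^k_0(T).$$ For all other elements set $\mathcal{L}_T=0$. The global lifting $\mathcal{L}$, defined on functions that are elementwise $H^1$, is given by $\mathcal{L}(u)|_T:=\mathcal{L}_T(u|_T)$. In general $\mathcal{L}(u)$ is discontinuous across element interfaces. *)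

theory Defs
  imports "HOL-Analysis.Analysis"
begin

section \<open>Domain and mesh\<close>

definition polyhedral_domain :: "(real ^ 'd) set \<Rightarrow> bool" where
  "polyhedral_domain \<Omega> \<longleftrightarrow> open \<Omega> \<and> connected \<Omega> \<and> bounded \<Omega> \<and> \<Omega> \<noteq> {} \<and>
     (\<exists>\<P>. finite \<P> \<and> (\<forall>P\<in>\<P>. polytope P) \<and> frontier \<Omega> = \<Union>\<P>)"

text \<open>The last conjunct says that the boundary does not cut through an element; it is automatic
  when \<open>\<Omega>\<close> is the interior of its closure, and matters only for slit domains.\<close>

definition fitted_triangulation :: "(real ^ 'd) set \<Rightarrow> (real ^ 'd) set set \<Rightarrow> bool" where
  "fitted_triangulation \<Omega> \<T> \<longleftrightarrow> triangulation \<T> \<and> (\<forall>T\<in>\<T>. int CARD('d) simplex T) \<and>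
     \<Union>\<T> = closure \<Omega> \<and> (\<forall>T\<in>\<T>. interior T \<subseteq> \<Omega>)"

definition inradius :: "(real ^ 'd) set \<Rightarrow> real" where
  "inradius T = Sup {r. 0 \<le> r \<and> (\<exists>x. cball x r \<subseteq> T)}"

definition shape_regular :: "real \<Rightarrow> (real ^ 'd) set set \<Rightarrow> bool" where
  "shape_regular \<sigma> \<T> \<longleftrightarrow> (\<forall>T\<in>\<T>. diameter T \<le> \<sigma> * inradius T)"

definition quasi_uniform :: "real \<Rightarrow> real \<Rightarrow> (real ^ 'd) set set \<Rightarrow> bool" where
  "quasi_uniform C h \<T> \<longleftrightarrow> (\<forall>T\<in>\<T>. diameter T \<le> C * h \<and> h \<le> C * diameter T)"

section \<open>Polynomial spaces\<close>

definition poly_fun :: "nat \<Rightarrow> (real ^ 'd \<Rightarrow> real) \<Rightarrow> bool" where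
  "poly_fun k p \<longleftrightarrow> (\<exists>c :: ('d \<Rightarrow> nat) \<Rightarrow> real.
     p = (\<lambda>x. \<Sum>\<alpha> | (\<Sum>i\<in>UNIV. \<alpha> i) \<le> k. c \<alpha> * (\<Prod>i\<in>UNIV. (x $ i) ^ \<alpha> i)))"

text \<open>A function on a set \<open>S\<close> is represented by any total function with the right values on \<open>S\<close>;
  none of the notions below depends on the values elsewhere.\<close>

definition Pk :: "nat \<Rightarrow> (real ^ 'd) set \<Rightarrow> (real ^ 'd \<Rightarrow> real) set" where
  "Pk k T = {u. \<exists>p. poly_fun k p \<and> (\<forall>x\<in>T. u x = p x)}"

definition Pk0 :: "nat \<Rightarrow> (real ^ 'd) set \<Rightarrow> (real ^ 'd \<Rightarrow> real) set" where
  "Pk0 k T = {u \<in> Pk k T. \<forall>c::real. (LINT x:T|lebesgue. u x * c) = 0}"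

definition fe_space :: "(real ^ 'd) set \<Rightarrow> (real ^ 'd) set set \<Rightarrow> nat \<Rightarrow> (real ^ 'd \<Rightarrow> real) set" where
  "fe_space \<Omega> \<T> k = {u. continuous_on (closure \<Omega>) u \<and> (\<forall>T\<in>\<T>. u \<in> Pk k T)}"

section \<open>Weak gradients and Sobolev spaces\<close>

definition L2_on :: "(real ^ 'd) set \<Rightarrow> (real ^ 'd \<Rightarrow> 'b::euclidean_space) \<Rightarrow> bool" where
  "L2_on U f \<longleftrightarrow> set_borel_measurable lebesgue U f \<and> set_integrable lebesgue U (\<lambda>x. (norm (f x))\<^sup>2)"

definition loc_integrable :: "(real ^ 'd) set \<Rightarrow> (real ^ 'd \<Rightarrow> 'b::euclidean_space) \<Rightarrow> bool" where
  "loc_integrable U f \<longleftrightarrow> (\<forall>K. compact K \<and> K \<subseteq> U \<longrightarrow> set_integrable lebesgue K f)"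

text \<open>\<open>\<phi>\<close> is a \<open>C\<^sup>1\<close> function with compact support in \<open>U\<close>, and \<open>\<psi>\<close> is its gradient.\<close>

definition test_fun :: "(real ^ 'd) set \<Rightarrow> (real ^ 'd \<Rightarrow> real) \<Rightarrow> (real ^ 'd \<Rightarrow> real ^ 'd) \<Rightarrow> bool" where
  "test_fun U \<phi> \<psi> \<longleftrightarrow> (\<forall>x. (\<phi> has_derivative (\<lambda>v. \<psi> x \<bullet> v)) (at x)) \<and> continuous_on UNIV \<psi> \<and>
     (\<exists>K. compact K \<and> K \<subseteq> U \<and> (\<forall>x. x \<notin> K \<longrightarrow> \<phi> x = 0))"

definition has_weak_grad :: "(real ^ 'd) set \<Rightarrow> (real ^ 'd \<Rightarrow> real) \<Rightarrow> (real ^ 'd \<Rightarrow> real ^ 'd) \<Rightarrow> bool" where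
  "has_weak_grad U u g \<longleftrightarrow> loc_integrable U u \<and> loc_integrable U g \<and>
     (\<forall>\<phi> \<psi>. test_fun U \<phi> \<psi> \<longrightarrow>
        (LINT x:U|lebesgue. u x *\<^sub>R \<psi> x) = - (LINT x:U|lebesgue. \<phi> x *\<^sub>R g x))"

text \<open>The weak gradient is determined up to a null set; the bilinear forms do not depend on the
  representative chosen here.\<close>

definition wgrad :: "(real ^ 'd) set \<Rightarrow> (real ^ 'd \<Rightarrow> real) \<Rightarrow> real ^ 'd \<Rightarrow> real ^ 'd" where
  "wgrad U u = (SOME g. has_weak_grad U u g)"

definition H1 :: "(real ^ 'd) set \<Rightarrow> (real ^ 'd \<Rightarrow> real) set" where
  "H1 U = {u. L2_on U u \<and> (\<exists>g. has_weak_grad U u g \<and> L2_on U g)}"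

definition H2 :: "(real ^ 'd) set \<Rightarrow> (real ^ 'd \<Rightarrow> real) set" where
  "H2 U = {u. L2_on U u \<and> (\<exists>g. has_weak_grad U u g \<and> (\<forall>i. (\<lambda>x. g x $ i) \<in> H1 U))}"

section \<open>Boundary traces and surface integrals\<close>

text \<open>The Sobolev trace on the boundary of a simplex \<open>T\<close>, taken from inside \<open>T\<close>: for \<open>f\<close> in \<open>H\<^sup>1(T)\<close>
  the limit of the averages exists and equals the trace of \<open>f\<close> at almost every boundary point
  (Evans and Gariepy, Measure Theory and Fine Properties of Functions, Section 5.3).
  It is insensitive to changes of \<open>f\<close> on null sets, and for \<open>f\<close> continuous on \<open>T\<close> it is
  the restriction of \<open>f\<close>.\<close>

definition bdry_trace :: "(real ^ 'd) set \<Rightarrow> (real ^ 'd \<Rightarrow> 'b::euclidean_space) \<Rightarrow> real ^ 'd \<Rightarrow> 'b" where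
  "bdry_trace T f y = Lim (at_right 0)
     (\<lambda>r. (1 / measure lebesgue (T \<inter> ball y r)) *\<^sub>R (LINT x:T \<inter> ball y r|lebesgue. f x))"

text \<open>The outward unit normal \<open>n\<close> of \<open>T\<close> on its facet \<open>F\<close>, together with the offset \<open>c\<close> of the
  hyperplane \<open>n \<bullet> x = c\<close> containing \<open>F\<close>. Both are unique if \<open>T\<close> has nonempty interior.\<close>

definition facet_plane :: "(real ^ 'd) set \<Rightarrow> (real ^ 'd) set \<Rightarrow> (real ^ 'd) \<times> real" where
  "facet_plane T F = (SOME (n, c). norm n = 1 \<and> T \<subseteq> {x. n \<bullet> x \<le> c} \<and> F = T \<inter> {x. n \<bullet> x = c})"

definition outer_normal :: "(real ^ 'd) set \<Rightarrow> (real ^ 'd) set \<Rightarrow> real ^ 'd" where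
  "outer_normal T F = fst (facet_plane T F)"

text \<open>The \<open>(d-1)\<close>-dimensional surface measure on the hyperplane \<open>n \<bullet> x = c\<close> with \<open>norm n = 1\<close>: the area
  of a Borel subset \<open>A\<close> of the hyperplane is the volume of the prism over \<open>A\<close> of height one.\<close>

definition plane_measure :: "real ^ 'd \<Rightarrow> real \<Rightarrow> (real ^ 'd) measure" where
  "plane_measure n c =
     distr (restrict_space lborel {x. c \<le> n \<bullet> x \<and> n \<bullet> x \<le> c + 1}) borel (\<lambda>x. x - (n \<bullet> x - c) *\<^sub>R n)"

definition facet_measure :: "(real ^ 'd) set \<Rightarrow> (real ^ 'd) set \<Rightarrow> (real ^ 'd) measure" where
  "facet_measure T F = (case facet_plane T F of (n, c) \<Rightarrow> plane_measure n c)"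

section \<open>Bilinear forms and lifting\<close>

definition a_loc :: "(real ^ 'd) set \<Rightarrow> (real ^ 'd \<Rightarrow> real) \<Rightarrow> (real ^ 'd \<Rightarrow> real) \<Rightarrow> real" where
  "a_loc T u v = (LINT x:T|lebesgue. wgrad (interior T) u x \<bullet> wgrad (interior T) v x)"

definition a_form :: "(real ^ 'd) set set \<Rightarrow> (real ^ 'd \<Rightarrow> real) \<Rightarrow> (real ^ 'd \<Rightarrow> real) \<Rightarrow> real" where
  "a_form \<T> u v = (\<Sum>T\<in>\<T>. a_loc T u v)"

definition normal_deriv :: "(real ^ 'd) set \<Rightarrow> (real ^ 'd) set \<Rightarrow> (real ^ 'd \<Rightarrow> real) \<Rightarrow> real ^ 'd \<Rightarrow> real" where
  "normal_deriv T F u y = bdry_trace T (wgrad (interior T) u) y \<bullet> outer_normal T F"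

text \<open>Up to a surface null set, the part of the boundary of \<open>\<Omega>\<close> on the boundary of \<open>T\<close> is the disjoint
  union of its parts on the facets of \<open>T\<close>.\<close>

definition Nc_loc ::
  "(real ^ 'd) set \<Rightarrow> (real ^ 'd) set \<Rightarrow> (real ^ 'd \<Rightarrow> real) \<Rightarrow> (real ^ 'd \<Rightarrow> real) \<Rightarrow> real" where
  "Nc_loc \<Omega> T u v = (\<Sum>F | F facet_of T.
     LINT y:frontier \<Omega> \<inter> F|facet_measure T F. - normal_deriv T F u y * bdry_trace T v y)"

definition Nc_form ::
  "(real ^ 'd) set \<Rightarrow> (real ^ 'd) set set \<Rightarrow> (real ^ 'd \<Rightarrow> real) \<Rightarrow> (real ^ 'd \<Rightarrow> real) \<Rightarrow> real" where
  "Nc_form \<Omega> \<T> u v = (\<Sum>T\<in>\<T>. Nc_loc \<Omega> T u v)"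

definition boundary_element :: "(real ^ 'd) set \<Rightarrow> (real ^ 'd) set \<Rightarrow> bool" where
  "boundary_element \<Omega> T \<longleftrightarrow> (\<exists>F. F facet_of T \<and> emeasure (facet_measure T F) (frontier \<Omega> \<inter> F) > 0)"

definition lift_loc ::
  "(real ^ 'd) set \<Rightarrow> nat \<Rightarrow> (real ^ 'd) set \<Rightarrow> (real ^ 'd \<Rightarrow> real) \<Rightarrow> real ^ 'd \<Rightarrow> real" where
  "lift_loc \<Omega> k T u =
     (if boundary_element \<Omega> T
      then (SOME w. w \<in> Pk0 k T \<and> (\<forall>v\<in>Pk0 k T. a_loc T w v = Nc_loc \<Omega> T v u))
      else (\<lambda>x. 0))"

text \<open>The global lifting is discontinuous across element interfaces, where it is set to \<open>0\<close>;
  the interfaces form a null set.\<close>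

definition lifting ::
  "(real ^ 'd) set \<Rightarrow> (real ^ 'd) set set \<Rightarrow> nat \<Rightarrow> (real ^ 'd \<Rightarrow> real) \<Rightarrow> real ^ 'd \<Rightarrow> real" where
  "lifting \<Omega> \<T> k u x = (\<Sum>T\<in>\<T>. indicator (interior T) x * lift_loc \<Omega> k T u x)"

definition Vreg_plus_Vh ::
  "(real ^ 'd) set \<Rightarrow> (real ^ 'd) set set \<Rightarrow> nat \<Rightarrow> (real ^ 'd \<Rightarrow> real) set" where
  "Vreg_plus_Vh \<Omega> \<T> k = {(\<lambda>x. u x + v x) | u v. u \<in> H2 \<Omega> \<and> v \<in> fe_space \<Omega> \<T> k}"

definition A_nn ::
  "(real ^ 'd) set \<Rightarrow> (real ^ 'd) set set \<Rightarrow> nat \<Rightarrow> (real ^ 'd \<Rightarrow> real) \<Rightarrow> (real ^ 'd \<Rightarrow> real) \<Rightarrow> real" where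
  "A_nn \<Omega> \<T> k = (\<lambda>u\<in>Vreg_plus_Vh \<Omega> \<T> k. \<lambda>v\<in>Vreg_plus_Vh \<Omega> \<T> k.
     a_form \<T> u v + Nc_form \<Omega> \<T> u v + Nc_form \<Omega> \<T> v u
       + 2 * a_form \<T> (lifting \<Omega> \<T> k u) (lifting \<Omega> \<T> k v))"

end

theory Submission
  imports Defs
begin

text \<open>
The estimate is local. On an element \<open>T\<close> write \<open>w\<close> for the lifting of \<open>u\<close>, and \<open>m\<close> for the mean of
\<open>u\<close> over \<open>T\<close>. Neither the gradient nor the normal derivative sees the constant \<open>m\<close>, so the
lifting may be tested with \<open>u - m\<close>, which has mean zero, and this turns the boundary term into a
volume term: \<open>Nc_loc \<Omega> T u u = a_loc T w u\<close>. The contribution of \<open>T\<close> to the form is then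
\<open>\<parallel>\<nabla>u\<parallel>\<^sup>2 + 2 (\<nabla>w, \<nabla>u) + 2 \<parallel>\<nabla>w\<parallel>\<^sup>2\<close>, that is, \<open>\<parallel>\<nabla>u\<parallel>\<^sup>2 / 2\<close> plus a complete square; summation
over the elements gives the theorem. On elements that are not boundary elements both \<open>w\<close> and the
boundary term vanish. This is \<open>element_coercivity\<close>.

Two things have to be supplied for this argument. The first is that the gradients and traces, which
are defined weakly (by choice of some weak gradient, and as limits of averages), are the
classical ones for polynomials. A continuously differentiable function has its classical
gradient as a weak gradient because the integral of the gradient of a compactly supported function
vanishes (\<open>integral_grad_eq_0\<close>), and two weak gradients agree almost everywhere because smooth bumps
approximate the indicator functions of boxes (\<open>weak_grad_unique_AE\<close>). The averages of a continuous
function over shrinking pieces of \<open>T\<close> converge to its value (\<open>bdry_trace_eq\<close>).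

The second is that the lifting exists, so that the choice in its definition yields a
solution of the defining equations. In the coefficients of polynomials the energy is a symmetric
positive semidefinite form. A polynomial of zero energy has zero gradient on \<open>T\<close>, hence
zero normal derivative on the boundary; so the right-hand side vanishes on the kernel of the
energy, which is the solvability condition of the finite-dimensional Riesz lemma
\<open>semidefinite_riesz\<close>. The solution is unique only up to constants there, and
subtraction of its mean puts it into the space of mean-zero polynomials (\<open>lift_loc_spec\<close>).
\<close>

section \<open>Continuously differentiable functions\<close>

definition has_cont_grad :: "(real ^ 'd \<Rightarrow> real) \<Rightarrow> (real ^ 'd \<Rightarrow> real ^ 'd) \<Rightarrow> bool" where
  "has_cont_grad f g \<longleftrightarrow>
     (\<forall>x. (f has_derivative (\<lambda>v. g x \<bullet> v)) (at x)) \<and> continuous_on UNIV g"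

lemma has_cont_grad_cont: "has_cont_grad f g \<Longrightarrow> continuous_on A f"
  unfolding has_cont_grad_def
  by (meson continuous_at_imp_continuous_on has_derivative_continuous)

lemma has_cont_grad_grad_cont: "has_cont_grad f g \<Longrightarrow> continuous_on A g"
  unfolding has_cont_grad_def by (meson continuous_on_subset subset_UNIV)

lemma has_cont_grad_const: "has_cont_grad (\<lambda>x. c) (\<lambda>x. 0)"
  unfolding has_cont_grad_def inner_zero_left by auto

lemma has_cont_grad_affine: "has_cont_grad (\<lambda>x. n \<bullet> x + c) (\<lambda>x. n)"
  unfolding has_cont_grad_def by (auto intro!: derivative_eq_intros)

lemma has_cont_grad_add:
  assumes "has_cont_grad f F" "has_cont_grad g G"
  shows "has_cont_grad (\<lambda>x. f x + g x) (\<lambda>x. F x + G x)"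
  using assms unfolding has_cont_grad_def inner_add_left
  by (intro conjI allI continuous_intros has_derivative_add) auto

lemma has_cont_grad_mult:
  assumes "has_cont_grad f F" "has_cont_grad g G"
  shows "has_cont_grad (\<lambda>x. f x * g x) (\<lambda>x. f x *\<^sub>R G x + g x *\<^sub>R F x)"
proof -
  have "((\<lambda>x. f x * g x) has_derivative (\<lambda>v. (f x *\<^sub>R G x + g x *\<^sub>R F x) \<bullet> v)) (at x)" for x
  proof -
    have "((\<lambda>x. f x * g x) has_derivative (\<lambda>v. f x * (G x \<bullet> v) + (F x \<bullet> v) * g x)) (at x)"
      using assms unfolding has_cont_grad_def by (intro has_derivative_mult) auto
    then show ?thesis by (simp add: inner_add_left mult.commute)
  qed
  moreover have "continuous_on UNIV (\<lambda>x. f x *\<^sub>R G x + g x *\<^sub>R F x)"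
    using assms by (intro continuous_intros has_cont_grad_cont has_cont_grad_grad_cont)
  ultimately show ?thesis unfolding has_cont_grad_def by blast
qed

lemma has_cont_grad_sum:
  assumes "\<And>i. i \<in> I \<Longrightarrow> has_cont_grad (f i) (F i)"
  shows "has_cont_grad (\<lambda>x. \<Sum>i\<in>I. f i x) (\<lambda>x. \<Sum>i\<in>I. F i x)"
  using assms
  by (induction I rule: infinite_finite_induct)
     (auto intro: has_cont_grad_const has_cont_grad_add)

lemma has_cont_grad_scale:
  assumes "has_cont_grad f F"
  shows "has_cont_grad (\<lambda>x. c * f x) (\<lambda>x. c *\<^sub>R F x)"
  using has_cont_grad_mult[OF has_cont_grad_const assms] by simp

lemma ex_has_cont_grad_prod:
  assumes "\<And>i. i \<in> I \<Longrightarrow> \<exists>F. has_cont_grad (f i) F"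
  shows "\<exists>F. has_cont_grad (\<lambda>x. \<Prod>i\<in>I. f i x) F"
  using assms
proof (induction I rule: infinite_finite_induct)
  case (insert i I)
  then obtain F G where "has_cont_grad (f i) F" "has_cont_grad (\<lambda>x. \<Prod>i\<in>I. f i x) G"
    by (meson insertCI)
  from has_cont_grad_mult[OF this] show ?case using insert.hyps by auto
qed (auto intro: has_cont_grad_const)

lemma has_cont_grad_compose:
  fixes s :: "real \<Rightarrow> real"
  assumes s: "\<And>t. (s has_real_derivative s' t) (at t)" "continuous_on UNIV s'"
    and f: "has_cont_grad f F"
  shows "has_cont_grad (\<lambda>x. s (f x)) (\<lambda>x. s' (f x) *\<^sub>R F x)"
proof -
  have "((\<lambda>x. s (f x)) has_derivative (\<lambda>v. (s' (f x) *\<^sub>R F x) \<bullet> v)) (at x)" for x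
    using DERIV_compose_FDERIV[OF s(1), of f "\<lambda>v. F x \<bullet> v" x UNIV] f
    unfolding has_cont_grad_def by (simp add: mult.commute)
  moreover have "continuous_on UNIV (\<lambda>x. s' (f x) *\<^sub>R F x)"
    using f by (intro continuous_intros continuous_on_compose2[OF s(2)] has_cont_grad_cont
        has_cont_grad_grad_cont) auto
  ultimately show ?thesis unfolding has_cont_grad_def by blast
qed

lemma has_cont_grad_unique_on_open:
  assumes "has_cont_grad f F" "has_cont_grad g G" "open U" "x \<in> U"
    and eq: "\<And>x. x \<in> U \<Longrightarrow> f x = g x"
  shows "F x = G x"
proof -
  have 1: "(f has_derivative (\<lambda>v. F x \<bullet> v)) (at x)" and "(g has_derivative (\<lambda>v. G x \<bullet> v)) (at x)"
    using assms unfolding has_cont_grad_def by auto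
  then have "(f has_derivative (\<lambda>v. G x \<bullet> v)) (at x)"
    using has_derivative_transform_within_open[OF _ \<open>open U\<close> \<open>x \<in> U\<close>] eq by metis
  then have "(\<lambda>v. F x \<bullet> v) = (\<lambda>v. G x \<bullet> v)" using 1 has_derivative_unique by blast
  then show ?thesis by (metis vector_eq_rdot)
qed

section \<open>Integration by parts against test functions\<close>

text \<open>The integral of the difference quotient \<open>(f (x + t e) - f x) / t\<close> is zero by translation invariance,
and the quotients converge to \<open>F x \<bullet> e\<close>, dominated by the Lipschitz constant of \<open>f\<close> on a ball.\<close>

lemma integral_grad_eq_0:
  fixes f :: "real ^ 'd \<Rightarrow> real"
  assumes fF: "has_cont_grad f F" and K: "compact K" and f0: "\<And>x. x \<notin> K \<Longrightarrow> f x = 0"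
  shows "integrable lebesgue F" and "(LINT x|lebesgue. F x) = 0"
proof -
  have contf: "continuous_on A f" and contF: "continuous_on A F" for A
    using fF has_cont_grad_cont has_cont_grad_grad_cont by blast+
  have F0: "F x = 0" if "x \<notin> K" for x
    using has_cont_grad_unique_on_open[OF fF has_cont_grad_const[of 0], of "- K" x] that K f0
    by (auto simp: compact_imp_closed open_Compl)
  have Fi: "F = (\<lambda>x. indicator K x *\<^sub>R F x)" using F0 by (auto simp: indicator_def)
  have intF: "integrable lborel F"
    using borel_integrable_compact[OF K contF] Fi by simp
  have [measurable]: "F \<in> borel_measurable borel" "f \<in> borel_measurable borel"
    by (auto intro: borel_measurable_continuous_onI contf contF)
  show "integrable lebesgue F" using intF by (simp add: integrable_completion)
  have "bounded (F ` K)" using K contF compact_continuous_image compact_imp_bounded by blast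
  then obtain M where M0: "0 < M" and MK: "\<And>x. x \<in> K \<Longrightarrow> norm (F x) \<le> M"
    by (metis bounded_pos image_eqI)
  have M: "norm (F x) \<le> M" for x using MK[of x] F0[of x] M0 by (cases "x \<in> K") auto
  have lip: "\<bar>f x - f y\<bar> \<le> M * norm (x - y)" for x y
  proof -
    have "norm (f x - f y) \<le> M * norm (x - y)"
    proof (rule differentiable_bound[of UNIV f "\<lambda>x v. F x \<bullet> v"])
      show "(f has_derivative (\<lambda>v. F x \<bullet> v)) (at x within UNIV)" for x
        using fF unfolding has_cont_grad_def by simp
      show "onorm (\<lambda>v. F x \<bullet> v) \<le> M" for x
      proof (rule onorm_bound)
        show "norm (F x \<bullet> v) \<le> M * norm v" for v
          using Cauchy_Schwarz_ineq2[of "F x" v] mult_right_mono[OF M[of x] norm_ge_zero[of v]]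
          by simp
      qed (use M0 in simp)
    qed auto
    then show ?thesis by simp
  qed
  obtain R where R: "K \<subseteq> cball 0 R" 
    using compact_imp_bounded[OF K] unfolding bounded_iff by (metis mem_cball_0 subsetI)
  have zero: "(LINT x|lborel. F x \<bullet> e) = 0" if e: "norm e = 1" for e
  proof -
    \<comment> \<open>The factor \<open>Suc n\<close> is the reciprocal of the step \<open>1 / Suc n\<close>; steps of length at most one
      keep the supports of all the quotients in the ball of radius \<open>R + 1\<close>.\<close>
    define q where "q = (\<lambda>(n::nat) x. (f (x + (1 / Suc n) *\<^sub>R e) - f x) * Suc n)"
    have intf: "integrable lborel f"
    proof -
      have "f = (\<lambda>x. indicator K x *\<^sub>R f x)" using f0 by (fastforce simp: indicator_def)
      then show ?thesis using borel_integrable_compact[OF K contf] by simp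
    qed
    have shift: "integrable lborel (\<lambda>x. f (x + c))" "(LINT x|lborel. f (x + c)) = (LINT x|lborel. f x)" for c
    proof -
      have "integrable (distr lborel borel ((+) c)) f" using intf by (simp add: lborel_distr_plus)
      then show "integrable lborel (\<lambda>x. f (x + c))"
        by (subst (asm) integrable_distr_eq) (auto simp: add.commute)
      have "(LINT x|lborel. f x) = (LINT x|distr lborel borel ((+) c). f x)"
        by (simp add: lborel_distr_plus)
      then show "(LINT x|lborel. f (x + c)) = (LINT x|lborel. f x)"
        by (subst (asm) integral_distr) (auto simp: add.commute)
    qed
    have q0: "(LINT x|lborel. q n x) = 0" for n
      unfolding q_def using shift intf by simp
    have "(\<lambda>n. LINT x|lborel. q n x) \<longlonglongrightarrow> (LINT x|lborel. F x \<bullet> e)"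
    proof (rule integral_dominated_convergence[where w = "\<lambda>x. indicator (cball 0 (R + 1)) x *\<^sub>R M"])
      show "integrable lborel (\<lambda>x. indicator (cball 0 (R + 1)) x *\<^sub>R M)"
        by (rule borel_integrable_compact) auto
      show "AE x in lborel. (\<lambda>n. q n x) \<longlonglongrightarrow> F x \<bullet> e"
      proof (rule AE_I2)
        fix x
        have "((\<lambda>t. f (x + t *\<^sub>R e)) has_derivative (\<lambda>t. F x \<bullet> (t *\<^sub>R e))) (at 0)"
        proof (rule has_derivative_compose[of "\<lambda>t. x + t *\<^sub>R e" "\<lambda>t. t *\<^sub>R e" 0 UNIV f])
          show "((\<lambda>t. x + t *\<^sub>R e) has_derivative (\<lambda>t. t *\<^sub>R e)) (at 0)"
            by (auto intro!: derivative_eq_intros)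
          show "(f has_derivative (\<lambda>v. F x \<bullet> v)) (at (x + 0 *\<^sub>R e))"
            using fF unfolding has_cont_grad_def by simp
        qed
        then have "((\<lambda>t. f (x + t *\<^sub>R e)) has_real_derivative F x \<bullet> e) (at 0)"
          unfolding has_field_derivative_def by (simp add: mult_commute_abs)
        then have "((\<lambda>t. (f (x + t *\<^sub>R e) - f x) / t) \<longlongrightarrow> F x \<bullet> e) (at 0)"
          by (simp add: has_field_derivative_iff)
        moreover have "filterlim (\<lambda>n::nat. 1 / real (Suc n)) (at 0) sequentially"
        proof -
          have "(\<lambda>n::nat. 1 / real (Suc n)) \<longlonglongrightarrow> 0"
            using LIMSEQ_inverse_real_of_nat by (simp add: inverse_eq_divide)
          then show ?thesis by (simp add: filterlim_at)
        qed
        ultimately have "(\<lambda>n. (f (x + (1 / real (Suc n)) *\<^sub>R e) - f x) / (1 / real (Suc n))) \<longlonglongrightarrow> F x \<bullet> e"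
          by (rule filterlim_compose)
        then show "(\<lambda>n. q n x) \<longlonglongrightarrow> F x \<bullet> e" unfolding q_def by simp
      qed
      show "AE x in lborel. norm (q n x) \<le> indicator (cball 0 (R + 1)) x *\<^sub>R M" for n
      proof (rule AE_I2)
        fix x
        have "\<bar>f (x + (1 / Suc n) *\<^sub>R e) - f x\<bar> \<le> M * (1 / Suc n)"
          using lip[of "x + (1 / Suc n) *\<^sub>R e" x] e by simp
        then have "\<bar>f (x + (1 / Suc n) *\<^sub>R e) - f x\<bar> * Suc n \<le> M"
          by (simp only: times_divide_eq_right mult_1_right pos_le_divide_eq of_nat_0_less_iff zero_less_Suc)
        then have le: "norm (q n x) \<le> M"
          unfolding q_def by (simp only: real_norm_def abs_mult abs_of_nat)
        have "q n x = 0" if "x \<notin> cball 0 (R + 1)"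
        proof -
          have nx: "norm x > R + 1" using that by simp
          have "norm ((1 / Suc n) *\<^sub>R e) \<le> 1" using e by simp
          then have "norm (x + (1 / Suc n) *\<^sub>R e) > R"
            using nx norm_diff_ineq[of x "(1 / Suc n) *\<^sub>R e"] by linarith
          then have "x + (1 / Suc n) *\<^sub>R e \<notin> K" "x \<notin> K" using R nx by fastforce+
          then show ?thesis unfolding q_def using f0 by simp
        qed
        then show "norm (q n x) \<le> indicator (cball 0 (R + 1)) x *\<^sub>R M"
          using le by (cases "x \<in> cball 0 (R + 1)") auto
      qed
    qed (auto simp: q_def)
    then show ?thesis by (simp add: q0 LIMSEQ_const_iff)
  qed
  have "(LINT x|lborel. F x) \<bullet> e = 0 \<bullet> e" if "e \<in> Basis" for e
  proof -
    have "(LINT x|lborel. F x \<bullet> e) = (LINT x|lborel. F x) \<bullet> e"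
      by (rule integral_inner_left) (rule intF)
    then show ?thesis using zero[of e] norm_Basis[OF that] by (simp only: inner_zero_left)
  qed
  then have "(LINT x|lborel. F x) = 0" by (rule euclidean_eqI)
  moreover have "(LINT x|lebesgue. F x) = (LINT x|lborel. F x)"
    by (rule integral_completion) simp
  ultimately show "(LINT x|lebesgue. F x) = 0" by (simp only:)
qed

lemma test_fun_iff:
  "test_fun U \<phi> \<psi> \<longleftrightarrow> has_cont_grad \<phi> \<psi> \<and> (\<exists>K. compact K \<and> K \<subseteq> U \<and> (\<forall>x. x \<notin> K \<longrightarrow> \<phi> x = 0))"
  unfolding test_fun_def has_cont_grad_def by blast

lemma set_integrable_lebesgue_compact:
  fixes f :: "real ^ 'd \<Rightarrow> 'b::euclidean_space"
  assumes "compact K" "continuous_on K f"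
  shows "set_integrable lebesgue K f"
proof -
  have "integrable lborel (\<lambda>x. indicator K x *\<^sub>R f x)" using borel_integrable_compact assms by blast
  then show ?thesis unfolding set_integrable_def
    by (simp add: integrable_completion borel_measurable_integrable)
qed

text \<open>For a test function \<open>\<phi>\<close> with gradient \<open>\<psi>\<close> the field \<open>p \<psi> + \<phi> P\<close> is the gradient of the compactly
supported function \<open>p \<phi>\<close>, so its integral vanishes.\<close>

lemma has_weak_grad_of_cont_grad:
  assumes pP: "has_cont_grad p P" and u: "\<And>x. x \<in> U \<Longrightarrow> u x = p x"
  shows "has_weak_grad U u P"
  unfolding has_weak_grad_def loc_integrable_def
proof (intro conjI allI impI)
  fix K assume K: "compact K \<and> K \<subseteq> U"
  show "set_integrable lebesgue K P"
    using K pP by (intro set_integrable_lebesgue_compact) (auto intro: has_cont_grad_grad_cont)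
  have "continuous_on K u"
    using has_cont_grad_cont[OF pP, of K] u K by (metis (no_types, lifting) continuous_on_cong in_mono)
  then show "set_integrable lebesgue K u" using K set_integrable_lebesgue_compact by blast
next
  fix \<phi> \<psi> assume "test_fun U \<phi> \<psi>"
  then obtain K where \<phi>: "has_cont_grad \<phi> \<psi>" and K: "compact K" "K \<subseteq> U" and \<phi>0: "\<And>x. x \<notin> K \<Longrightarrow> \<phi> x = 0"
    unfolding test_fun_iff by blast
  have \<psi>0: "\<psi> x = 0" if "x \<notin> K" for x
    using has_cont_grad_unique_on_open[OF \<phi> has_cont_grad_const[of 0], of "- K" x] that K \<phi>0
    by (auto simp: compact_imp_closed open_Compl)
  have int: "integrable lebesgue (\<lambda>x. indicator K x *\<^sub>R (p x *\<^sub>R \<psi> x))"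
            "integrable lebesgue (\<lambda>x. indicator K x *\<^sub>R (\<phi> x *\<^sub>R P x))"
    using K pP \<phi> has_cont_grad_cont has_cont_grad_grad_cont
    by (fold set_integrable_def; intro set_integrable_lebesgue_compact continuous_intros; blast)+
  have e1: "(\<lambda>x. indicator K x *\<^sub>R (p x *\<^sub>R \<psi> x)) = (\<lambda>x. p x *\<^sub>R \<psi> x)"
    and e2: "(\<lambda>x. indicator K x *\<^sub>R (\<phi> x *\<^sub>R P x)) = (\<lambda>x. \<phi> x *\<^sub>R P x)"
    and e3: "(\<lambda>x. indicator U x *\<^sub>R (u x *\<^sub>R \<psi> x)) = (\<lambda>x. p x *\<^sub>R \<psi> x)"
    and e4: "(\<lambda>x. indicator U x *\<^sub>R (\<phi> x *\<^sub>R P x)) = (\<lambda>x. \<phi> x *\<^sub>R P x)"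
    using \<psi>0 \<phi>0 K u by (auto simp: indicator_def fun_eq_iff)
  have "(LINT x|lebesgue. p x *\<^sub>R \<psi> x + \<phi> x *\<^sub>R P x) = 0"
    using integral_grad_eq_0(2)[OF has_cont_grad_mult[OF pP \<phi>] K(1)] \<phi>0 by simp
  then show "(LINT x:U|lebesgue. u x *\<^sub>R \<psi> x) = - (LINT x:U|lebesgue. \<phi> x *\<^sub>R P x)"
    unfolding set_lebesgue_integral_def e3 e4 using int unfolding e1 e2
    by (simp add: eq_neg_iff_add_eq_0)
qed

section \<open>Uniqueness of the weak gradient\<close>

text \<open>The boxes are a generator of the Borel sets that is stable under intersection, so the vanishing of the
integral passes to all Borel sets by a Dynkin argument, and then to Lebesgue sets, which differ
from Borel sets by null sets.\<close>

lemma AE_eq_0_if_box_integrals_eq_0: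
  fixes f :: "'a::euclidean_space \<Rightarrow> 'b::euclidean_space"
  assumes f: "integrable lebesgue f" and box: "\<And>a b. (LINT x:box a b|lebesgue. f x) = 0"
  shows "AE x in lebesgue. f x = 0"
proof -
  interpret lebesgue: sigma_finite_measure "lebesgue :: 'a measure"
  proof
    obtain A :: "'a set set" where "countable A" "A \<subseteq> sets lborel" "\<Union>A = space lborel"
      "\<forall>a\<in>A. emeasure lborel a \<noteq> \<infinity>"
      using lborel.sigma_finite_countable by blast
    then show "\<exists>A::'a set set. countable A \<and> A \<subseteq> sets lebesgue \<and> \<Union>A = space lebesgue \<and>
        (\<forall>a\<in>A. emeasure lebesgue a \<noteq> \<infinity>)"
      by (intro exI[of _ A]) (auto intro: sets_completionI_sets)
  qed
  show ?thesis
  proof (rule lebesgue.density_zero[OF f])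
  have sint: "set_integrable lebesgue A f" if "A \<in> sets lebesgue" for A
    using f that unfolding set_integrable_def by (rule integrable_mult_indicator[rotated])
  have UNIV0: "(LINT x:UNIV|lebesgue. f x) = 0"
  proof -
    define A where "A = (\<lambda>n::nat. box (- (real n *\<^sub>R One)) (real n *\<^sub>R One) :: 'a set)"
    have "(\<lambda>n. LINT x:A n|lebesgue. f x) \<longlonglongrightarrow> (LINT x:(\<Union>n. A n)|lebesgue. f x)"
    proof (rule set_integral_cont_up)
      have "A m \<subseteq> A n" if "m \<le> n" for m n
        unfolding A_def using that by (intro subset_box_imp) (auto intro: mult_right_mono)
      then show "incseq A" by (simp add: incseq_def)
    qed (auto simp: A_def intro: sint)
    then have "(LINT x:(\<Union>n. A n)|lebesgue. f x) = 0"
      unfolding A_def box by (simp add: LIMSEQ_const_iff)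
    then show ?thesis unfolding A_def UN_box_eq_UNIV .
  qed
  have borel0: "(LINT x:A|lebesgue. f x) = 0" if "A \<in> sets borel" for A
  proof -
    let ?G = "range (\<lambda>(a, b). box a b :: 'a set)"
    have leb: "B \<in> sets lebesgue" if "B \<in> sigma_sets UNIV ?G" for B
    proof -
      have "B \<in> sets borel" using that by (subst borel_eq_box) (simp add: sets_measure_of)
      then show ?thesis by simp
    qed
    have "Int_stable ?G" by (auto simp: Int_stable_def box_Int_box)
    moreover have "?G \<subseteq> Pow UNIV" by simp
    moreover have "A \<in> sigma_sets UNIV ?G"
      using that by (subst (asm) borel_eq_box) (simp add: sets_measure_of)
    ultimately show ?thesis
    proof (induction rule: sigma_sets_induct_disjoint)
      case (compl A)
      have "(LINT x:A \<union> (UNIV - A)|lebesgue. f x) = (LINT x:A|lebesgue. f x) + (LINT x:UNIV - A|lebesgue. f x)"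
        using leb[OF compl(1)] by (intro set_integral_Un sint) auto
      then show ?case using UNIV0 compl by simp
    next
      case (union A)
      have "(LINT x:(\<Union>i. A i)|lebesgue. f x) = (\<Sum>i. LINT x:A i|lebesgue. f x)"
      proof (rule lebesgue_integral_countable_add)
        show "A i \<in> sets lebesgue" for i using union leb by auto
        then show "set_integrable lebesgue (\<Union>i. A i) f" by (intro sint) auto
        show "A i \<inter> A j = {}" if "i \<noteq> j" for i j
          using union(1) that unfolding disjoint_family_on_def by auto
      qed
      then show ?case using union by simp
    next
      case empty
      show ?case by (simp add: set_lebesgue_integral_def)
    qed (auto simp: box)
  qed
  show "(LINT x:A|lebesgue. f x) = 0" if A: "A \<in> sets lebesgue" for A
  proof -
    obtain N where N: "N \<in> null_sets lborel" "null_part lborel A \<subseteq> N" using null_part[OF A] by blast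
    have "AE x in lebesgue. x \<notin> N" using N by (intro AE_not_in null_sets_completionI)
    then have "AE x in lebesgue. x \<in> main_part lborel A \<longleftrightarrow> x \<in> A"
      by eventually_elim (use N main_part_null_part_Un[OF A] in blast)
    moreover have "main_part lborel A \<in> sets lebesgue" "main_part lborel A \<in> sets borel"
      using main_part_sets[OF A] by (auto intro: sets_completionI_sets)
    ultimately have "(LINT x:A|lebesgue. f x) = (LINT x:main_part lborel A|lebesgue. f x)"
      using A sint by (intro set_integral_cong_set)
       (auto simp: set_borel_measurable_def set_integrable_def intro!: borel_measurable_integrable)
    then show ?thesis using borel0 \<open>main_part lborel A \<in> sets borel\<close> by simp
  qed
  qed
qed

text \<open>A continuously differentiable step: \<open>smooth_step (n t)\<close> tends to the indicator function of \<open>t > 0\<close>.\<close>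

definition smooth_step :: "real \<Rightarrow> real" where
  "smooth_step t = (max 0 t)\<^sup>2 / (1 + t\<^sup>2)"

lemma smooth_step_bounds: "0 \<le> smooth_step t" "smooth_step t \<le> 1"
proof -
  have "(max 0 t)\<^sup>2 \<le> t\<^sup>2" by (simp add: max_def)
  then show "smooth_step t \<le> 1" unfolding smooth_step_def
    by (subst divide_le_eq_1_pos) (auto intro: add_pos_nonneg)
qed (simp add: smooth_step_def)

lemma smooth_step_eq_0: "t \<le> 0 \<Longrightarrow> smooth_step t = 0"
  by (simp add: smooth_step_def)

lemma smooth_step_limit:
  assumes "t > 0"
  shows "(\<lambda>n. smooth_step (real n * t)) \<longlonglongrightarrow> 1"
proof -
  have "(\<lambda>n. (real n * t)\<^sup>2 / (1 + (real n * t)\<^sup>2)) \<longlonglongrightarrow> 1"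
    using assms by real_asymp
  then show ?thesis using assms by (simp add: smooth_step_def)
qed

lemma smooth_step_has_cont_deriv:
  "\<exists>s'. (\<forall>t. (smooth_step has_real_derivative s' t) (at t)) \<and> continuous_on UNIV s'"
proof -
  have sq: "((\<lambda>t::real. (max 0 t)\<^sup>2) has_real_derivative 2 * max 0 t) (at t)" for t
  proof (cases t "0::real" rule: linorder_cases)
    case less
    show ?thesis
      by (rule has_field_derivative_transform_within_open[of "\<lambda>t. 0" _ _ "{..<0}"])
         (use less in auto)
  next
    case greater
    show ?thesis
      by (rule has_field_derivative_transform_within_open[of "\<lambda>t. t\<^sup>2" _ _ "{0<..}"])
         (use greater in \<open>auto intro!: derivative_eq_intros\<close>)
  next
    case equal
    have "((\<lambda>h::real. max 0 h) \<longlongrightarrow> max 0 0) (at 0)"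
      by (intro tendsto_intros)
    moreover have "\<forall>\<^sub>F h::real in at 0. max 0 h = (max 0 h)\<^sup>2 / h"
      unfolding eventually_at_filter by (rule always_eventually) (auto simp: max_def power2_eq_square)
    ultimately have "((\<lambda>h::real. (max 0 h)\<^sup>2 / h) \<longlongrightarrow> 0) (at 0)"
      using Lim_transform_eventually by fastforce
    then show ?thesis unfolding equal by (simp add: has_field_derivative_iff)
  qed
  have pos: "1 + t\<^sup>2 \<noteq> 0" for t :: real by (metis add_pos_nonneg less_numeral_extra(1) less_irrefl zero_le_power2)
  define s' where
    "s' = (\<lambda>t::real. (2 * max 0 t * (1 + t\<^sup>2) - (max 0 t)\<^sup>2 * (2 * t)) / ((1 + t\<^sup>2) * (1 + t\<^sup>2)))"
  have "(smooth_step has_real_derivative s' t) (at t)" for t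
    unfolding smooth_step_def[abs_def] s'_def
    by (rule DERIV_divide[OF sq]) (use pos in \<open>auto intro!: derivative_eq_intros\<close>)
  moreover have "continuous_on UNIV s'" unfolding s'_def
    by (intro continuous_intros) (use pos in auto)
  ultimately show ?thesis by blast
qed

text \<open>Test functions that increase to sharp cut-offs: they vanish outside the open box for every \<open>n\<close>, and
tend to its indicator function pointwise.\<close>

definition box_bump :: "real ^ 'd \<Rightarrow> real ^ 'd \<Rightarrow> nat \<Rightarrow> real ^ 'd \<Rightarrow> real" where
  "box_bump a b n x =
     (\<Prod>i\<in>UNIV. smooth_step (real n * (x $ i - a $ i)) * smooth_step (real n * (b $ i - x $ i)))"

lemma box_bump_outside: "x \<notin> box a b \<Longrightarrow> box_bump a b n x = 0"
proof -
  assume "x \<notin> box a b"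
  then obtain i where "x $ i - a $ i \<le> 0 \<or> b $ i - x $ i \<le> 0"
    by (auto simp: mem_box_cart not_less)
  then have "smooth_step (real n * (x $ i - a $ i)) * smooth_step (real n * (b $ i - x $ i)) = 0"
    by (auto intro!: smooth_step_eq_0 mult_nonneg_nonpos)
  then show ?thesis unfolding box_bump_def by (metis (no_types, lifting) UNIV_I finite prod_zero)
qed

lemma box_bump_bound: "\<bar>box_bump a b n x\<bar> \<le> 1"
  unfolding box_bump_def abs_prod
  by (rule prod_le_1) (auto simp: abs_mult smooth_step_bounds intro!: mult_le_one)

lemma box_bump_limit: "(\<lambda>n. box_bump a b n x) \<longlonglongrightarrow> indicator (box a b) x"
proof (cases "x \<in> box a b")
  case True
  have "(\<lambda>n. box_bump a b n x) \<longlonglongrightarrow> (\<Prod>i\<in>(UNIV::'a set). 1 * 1)"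
    unfolding box_bump_def
    by (intro tendsto_prod tendsto_mult smooth_step_limit) (use True in \<open>auto simp: mem_box_cart\<close>)
  then show ?thesis using True by simp
qed (simp add: box_bump_outside)

lemma box_bump_has_cont_grad: "\<exists>G. has_cont_grad (box_bump a b n) G"
proof -
  obtain s' where s': "\<And>t. (smooth_step has_real_derivative s' t) (at t)" "continuous_on UNIV s'"
    using smooth_step_has_cont_deriv by blast
  have 1: "\<exists>F. has_cont_grad (\<lambda>x. smooth_step (real n * (x $ i - a $ i))) F" for i
    using has_cont_grad_compose[OF s' has_cont_grad_affine[of "real n *\<^sub>R axis i 1" "- real n * a $ i"]]
    by (auto simp: inner_axis' algebra_simps)
  have 2: "\<exists>F. has_cont_grad (\<lambda>x. smooth_step (real n * (b $ i - x $ i))) F" for i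
    using has_cont_grad_compose[OF s' has_cont_grad_affine[of "- real n *\<^sub>R axis i 1" "real n * b $ i"]]
    by (auto simp: inner_axis' algebra_simps)
  show ?thesis unfolding box_bump_def
    by (rule ex_has_cont_grad_prod) (use 1 2 has_cont_grad_mult in blast)
qed

text \<open>Both integrals are the limit of the pairings of the weak gradients with the bumps of the box, and these
pairings are determined by \<open>u\<close>. The closed box must lie in \<open>U\<close> because it carries the support of
the bumps.\<close>

lemma weak_grad_box_integral_unique:
  assumes g: "has_weak_grad U u g" and h: "has_weak_grad U u h" and ab: "cbox a b \<subseteq> U"
  shows "set_integrable lebesgue (box a b) g"
    and "(LINT x:box a b|lebesgue. g x) = (LINT x:box a b|lebesgue. h x)"
proof -
  have int: "set_integrable lebesgue (cbox a b) k" if "has_weak_grad U u k" for k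
    using that ab unfolding has_weak_grad_def loc_integrable_def by auto
  show "set_integrable lebesgue (box a b) g"
    by (rule set_integrable_subset[OF int[OF g]]) (auto simp: box_subset_cbox)
  have lim: "(\<lambda>n. LINT x:U|lebesgue. box_bump a b n x *\<^sub>R k x) \<longlonglongrightarrow> (LINT x:box a b|lebesgue. k x)"
    if k: "has_weak_grad U u k" for k
  proof -
    have k'[measurable]: "integrable lebesgue (\<lambda>x. indicator (cbox a b) x *\<^sub>R k x)"
      using int[OF k] unfolding set_integrable_def .
    have [measurable]: "box_bump a b n \<in> borel_measurable lebesgue" for n
    proof -
      have "continuous_on UNIV (box_bump a b n)" using box_bump_has_cont_grad has_cont_grad_cont by blast
      then show ?thesis by (intro measurable_completion) (simp add: borel_measurable_continuous_onI)
    qed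
    have e1: "indicator U x *\<^sub>R (box_bump a b n x *\<^sub>R k x) = box_bump a b n x *\<^sub>R (indicator (cbox a b) x *\<^sub>R k x)" for n x
      using ab box_bump_outside[of x a b n] box_subset_cbox[of a b]
      by (cases "x \<in> box a b") (auto simp: indicator_def)
    have e2: "indicator (box a b) x *\<^sub>R k x = indicator (box a b) x *\<^sub>R (indicator (cbox a b) x *\<^sub>R k x)" for x
      using box_subset_cbox[of a b] by (auto simp: indicator_def)
    show ?thesis unfolding set_lebesgue_integral_def e1
      apply (subst e2)
    proof (rule integral_dominated_convergence[where w = "\<lambda>x. norm (indicator (cbox a b) x *\<^sub>R k x)"])
      show "AE x in lebesgue. (\<lambda>n. box_bump a b n x *\<^sub>R (indicator (cbox a b) x *\<^sub>R k x))
              \<longlonglongrightarrow> indicator (box a b) x *\<^sub>R (indicator (cbox a b) x *\<^sub>R k x)"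
        by (intro AE_I2 tendsto_scaleR box_bump_limit tendsto_const)
      show "AE x in lebesgue. norm (box_bump a b n x *\<^sub>R (indicator (cbox a b) x *\<^sub>R k x))
              \<le> norm (indicator (cbox a b) x *\<^sub>R k x)" for n
        unfolding norm_scaleR[of "box_bump a b n _"]
        by (intro AE_I2 mult_left_le_one_le) (auto simp: box_bump_bound)
      show "(\<lambda>x. indicator (box a b) x *\<^sub>R (indicator (cbox a b) x *\<^sub>R k x)) \<in> borel_measurable lebesgue"
        by (intro borel_measurable_scaleR borel_measurable_integrable[OF k'] borel_measurable_indicator) simp
      show "(\<lambda>x. box_bump a b n x *\<^sub>R (indicator (cbox a b) x *\<^sub>R k x)) \<in> borel_measurable lebesgue" for n
        by (intro borel_measurable_scaleR borel_measurable_integrable[OF k']) simp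
      show "integrable lebesgue (\<lambda>x. norm (indicator (cbox a b) x *\<^sub>R k x))"
        using k' by (rule integrable_norm)
    qed
  qed
  have "(LINT x:U|lebesgue. box_bump a b n x *\<^sub>R g x) = (LINT x:U|lebesgue. box_bump a b n x *\<^sub>R h x)" for n
  proof -
    obtain G where "has_cont_grad (box_bump a b n) G" using box_bump_has_cont_grad by blast
    then have "test_fun U (box_bump a b n) G"
      unfolding test_fun_iff using ab box_bump_outside box_subset_cbox[of a b]
      by (metis compact_cbox subsetD)
    then have "(LINT x:U|lebesgue. u x *\<^sub>R G x) = - (LINT x:U|lebesgue. box_bump a b n x *\<^sub>R g x)"
      "(LINT x:U|lebesgue. u x *\<^sub>R G x) = - (LINT x:U|lebesgue. box_bump a b n x *\<^sub>R h x)"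
      using g h unfolding has_weak_grad_def by blast+
    then show ?thesis by simp
  qed
  then show "(LINT x:box a b|lebesgue. g x) = (LINT x:box a b|lebesgue. h x)"
    using lim[OF g] lim[OF h] LIMSEQ_unique by simp
qed

lemma weak_grad_unique_AE:
  fixes g h :: "real ^ 'd \<Rightarrow> real ^ 'd"
  assumes g: "has_weak_grad U u g" and h: "has_weak_grad U u h" and U: "open U"
  shows "AE x in lebesgue. x \<in> U \<longrightarrow> g x = h x"
proof -
  have box: "AE x in lebesgue. x \<in> box a b \<longrightarrow> g x = h x" if ab: "cbox a b \<subseteq> U" for a b
  proof -
    have int: "integrable lebesgue (\<lambda>x. indicator (box a b) x *\<^sub>R g x)"
      "integrable lebesgue (\<lambda>x. indicator (box a b) x *\<^sub>R h x)"
      using weak_grad_box_integral_unique(1)[OF g g ab] weak_grad_box_integral_unique(1)[OF h h ab]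
      unfolding set_integrable_def by auto
    have "AE x in lebesgue. indicator (box a b) x *\<^sub>R g x - indicator (box a b) x *\<^sub>R h x = 0"
    proof (rule AE_eq_0_if_box_integrals_eq_0)
      show "integrable lebesgue (\<lambda>x. indicator (box a b) x *\<^sub>R g x - indicator (box a b) x *\<^sub>R h x)"
        using int by simp
      show "(LINT x:box c d|lebesgue. indicator (box a b) x *\<^sub>R g x - indicator (box a b) x *\<^sub>R h x) = 0" for c d
      proof -
        obtain a' b' where ab': "box c d \<inter> box a b = box a' b'" using box_Int_box by blast
        show ?thesis
        proof (cases "box a' b' = {}")
          case True
          then have "indicator (box c d) x *\<^sub>R (indicator (box a b) x *\<^sub>R g x - indicator (box a b) x *\<^sub>R h x) = 0" for x
            using ab' by (auto simp: indicator_def)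
          then show ?thesis unfolding set_lebesgue_integral_def by (simp only: integral_zero)
        next
          case False
          have "cbox a' b' \<subseteq> cbox a b"
            using ab' closure_mono[of "box a' b'" "box a b"] False
            by (metis Int_lower2 box_subset_cbox closed_cbox closure_box closure_minimal order_trans order_refl)
          then have sub: "cbox a' b' \<subseteq> U" using ab by blast
          have "indicator (box c d) x *\<^sub>R (indicator (box a b) x *\<^sub>R g x - indicator (box a b) x *\<^sub>R h x)
            = indicator (box a' b') x *\<^sub>R g x - indicator (box a' b') x *\<^sub>R h x" for x
            unfolding ab'[symmetric] by (simp add: indicator_def)
          then show ?thesis
            using weak_grad_box_integral_unique(1)[OF g g sub] weak_grad_box_integral_unique(1)[OF h h sub]
              weak_grad_box_integral_unique(2)[OF g h sub]
            unfolding set_lebesgue_integral_def set_integrable_def by simp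
        qed
      qed
    qed
    then show ?thesis by eventually_elim (auto simp: indicator_def)
  qed
  \<comment> \<open>A countable family of closed boxes exhausts the open set.\<close>
  define a' b' :: "(real ^ 'd \<Rightarrow> real \<times> real) \<Rightarrow> real ^ 'd"
    where "a' = (\<lambda>f. \<Sum>i\<in>Basis. fst (f i) *\<^sub>R i)" and "b' = (\<lambda>f. \<Sum>i\<in>Basis. snd (f i) *\<^sub>R i)"
  define I where "I = {f \<in> Basis \<rightarrow>\<^sub>E \<rat> \<times> \<rat>. cbox (a' f) (b' f) \<subseteq> U}"
  have U_eq: "U = (\<Union>f\<in>I. cbox (a' f) (b' f))"
    unfolding I_def a'_def b'_def by (rule open_UNION_cbox[OF U])
  have "countable I" unfolding I_def
    by (intro countable_Collect countable_PiE) (auto simp: countable_rat)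
  moreover have "AE x in lebesgue. x \<in> cbox (a' f) (b' f) \<longrightarrow> g x = h x" if "f \<in> I" for f
  proof -
    have "cbox (a' f) (b' f) \<subseteq> U" using that I_def by auto
    moreover have "AE x in lebesgue. x \<notin> cbox (a' f) (b' f) - box (a' f) (b' f)"
      by (rule AE_not_in) (use negligible_frontier_interval negligible_iff_null_sets in blast)
    ultimately show ?thesis using box by fastforce
  qed
  ultimately have "AE x in lebesgue. \<forall>f\<in>I. x \<in> cbox (a' f) (b' f) \<longrightarrow> g x = h x"
    by (subst AE_ball_countable) auto
  then show ?thesis by eventually_elim (use U_eq in auto)
qed

section \<open>A Riesz representation for semidefinite forms\<close>

text \<open>If \<open>B e c\<close> were nonzero, the quadratic form would be the nonconstant affine function
\<open>B e e + 2 t B e c\<close> of \<open>t\<close> along the line \<open>e + t c\<close> and take negative values.\<close>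

lemma semidefinite_null_vector:
  fixes B :: "('i \<Rightarrow> real) \<Rightarrow> ('i \<Rightarrow> real) \<Rightarrow> real"
  assumes lin: "\<And>c d e t. B (\<lambda>i. c i + t * d i) e = B c e + t * B d e"
    and sym: "\<And>c d. B c d = B d c" and nonneg: "\<And>c. 0 \<le> B c c"
    and null: "B c c = 0"
  shows "B e c = 0"
proof (rule ccontr)
  assume ne: "B e c \<noteq> 0"
  \<comment> \<open>Chosen so that the form takes the value \<open>- 1\<close> at \<open>e + t c\<close>.\<close>
  define t where "t = - (B e e + 1) / (2 * B e c)"
  have "B (\<lambda>i. e i + t * c i) (\<lambda>i. e i + t * c i) = B e e + 2 * t * B e c"
    using lin[of e t c "\<lambda>i. e i + t * c i"] lin[of e t c e] lin[of e t c c] sym null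
    by (simp add: algebra_simps)
  also have "\<dots> < 0" using ne by (simp add: t_def field_simps)
  finally show False using nonneg[of "\<lambda>i. e i + t * c i"] by simp
qed

text \<open>Gram-Schmidt: the basis vectors are added one at a time. The new one is made orthogonal to the old
span by subtracting its projection \<open>p\<close>, which is itself provided by the induction hypothesis
applied to the functional \<open>B u\<close>. If the remainder \<open>e\<close> has \<open>B e e = 0\<close>, the representing vector stays as
it is, since the functional does not see \<open>e\<close> either; otherwise a multiple of \<open>e\<close> corrects
it.\<close>

lemma semidefinite_riesz:
  fixes B :: "('i \<Rightarrow> real) \<Rightarrow> ('i \<Rightarrow> real) \<Rightarrow> real" and l :: "('i \<Rightarrow> real) \<Rightarrow> real"
  assumes "finite J"
    and lin: "\<And>c d e t. B (\<lambda>i. c i + t * d i) e = B c e + t * B d e"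
    and sym: "\<And>c d. B c d = B d c" and nonneg: "\<And>c. 0 \<le> B c c"
    and "\<And>c d t. l (\<lambda>i. c i + t * d i) = l c + t * l d"
    and "\<And>c. B c c = 0 \<Longrightarrow> l c = 0"
  shows "\<exists>w. (\<forall>i. i \<notin> J \<longrightarrow> w i = 0) \<and> (\<forall>v. (\<forall>i. i \<notin> J \<longrightarrow> v i = 0) \<longrightarrow> B w v = l v)"
  using assms(1,5,6)
proof (induction J arbitrary: l rule: finite_induct)
  case (empty l)
  have B0: "B (\<lambda>i. 0) v = 0" for v using lin[of "\<lambda>i. 0" 1 "\<lambda>i. 0" v] by simp
  have "v = (\<lambda>i. 0)" if "\<forall>i. i \<notin> {} \<longrightarrow> v i = 0" for v :: "'i \<Rightarrow> real"
    using that by auto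
  moreover have "l (\<lambda>i. 0) = 0" using empty.prems(1)[of "\<lambda>i. 0" 1 "\<lambda>i. 0"] by simp
  ultimately show ?case using B0 by (intro exI[of _ "\<lambda>i. 0"]) metis
next
  case (insert j J l)
  have lin2: "B e (\<lambda>i. c i + t * d i) = B e c + t * B e d" for c d e t
    using lin sym by metis
  define u :: "'i \<Rightarrow> real" where "u = (\<lambda>i. if i = j then 1 else 0)"
  obtain w where wJ: "\<And>i. i \<notin> J \<Longrightarrow> w i = 0" and w: "\<And>v. (\<And>i. i \<notin> J \<Longrightarrow> v i = 0) \<Longrightarrow> B w v = l v"
    using insert.IH[of l] insert.prems by blast
  \<comment> \<open>The functional \<open>B u\<close> vanishes on null vectors of \<open>B\<close>, so that it is also admissible.\<close>
  obtain p where pJ: "\<And>i. i \<notin> J \<Longrightarrow> p i = 0" and p: "\<And>v. (\<And>i. i \<notin> J \<Longrightarrow> v i = 0) \<Longrightarrow> B p v = B u v"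
    using insert.IH[of "B u"] lin2 semidefinite_null_vector[of B, OF lin sym nonneg] by blast
  define e where "e = (\<lambda>i. u i + (- 1) * p i)"
  have e0: "B e v = 0" if "\<And>i. i \<notin> J \<Longrightarrow> v i = 0" for v
    using lin[of u "- 1" p v] p[OF that] unfolding e_def by simp
  have le: "l e = l u - l p" using insert.prems(1)[of u "- 1" p] unfolding e_def by simp
  have Bue: "B e u = B e e" using lin2[of e u "- 1" p] e0[OF pJ] unfolding e_def by simp
  define t where "t = (if B e e = 0 then 0 else (l u - B w u) / B e e)"
  define w' where "w' = (\<lambda>i. w i + t * e i)"
  have we: "B w e = 0" using e0[OF wJ] sym by simp
  have wu: "B w' u = l u"
  proof (cases "B e e = 0")
    case True
    have "B w u = B w p" using lin2[of w u "- 1" p] we unfolding e_def by simp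
    also have "\<dots> = l u" using w[OF pJ] le insert.prems(2)[OF True] by simp
    finally show ?thesis using lin[of w t e u] True unfolding w'_def t_def by simp
  next
    case False
    then show ?thesis using lin[of w t e u] Bue unfolding w'_def t_def by simp
  qed
  have "B w' v = l v" if v: "\<forall>i. i \<notin> insert j J \<longrightarrow> v i = 0" for v
  proof -
    define v' where "v' = v(j := 0)"
    have v'J: "v' i = 0" if "i \<notin> J" for i using that v unfolding v'_def by auto
    have veq: "v = (\<lambda>i. v' i + v j * u i)" unfolding v'_def u_def by auto
    have "B w' v = B w' v' + v j * B w' u" by (subst veq) (rule lin2)
    also have "B w' v' = l v'" using lin[of w t e v'] w[OF v'J] e0[OF v'J] unfolding w'_def by simp
    also have "l v' + v j * B w' u = l v"
      unfolding wu using insert.prems(1)[of v' "v j" u, folded veq] by simp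
    finally show ?thesis .
  qed
  moreover have "w' i = 0" if "i \<notin> insert j J" for i
    using that wJ pJ unfolding w'_def e_def u_def by auto
  ultimately show ?case by blast
qed

section \<open>Polynomials in coordinates\<close>

definition multi_indices :: "nat \<Rightarrow> ('d::finite \<Rightarrow> nat) set" where
  "multi_indices k = {\<alpha>. (\<Sum>i\<in>UNIV. \<alpha> i) \<le> k}"

definition monomial :: "('d \<Rightarrow> nat) \<Rightarrow> real ^ 'd \<Rightarrow> real" where
  "monomial \<alpha> x = (\<Prod>i\<in>UNIV. (x $ i) ^ \<alpha> i)"

text \<open>Chosen by \<open>SOME\<close>, since the only property used is that it is the gradient.\<close>

definition monomial_grad :: "('d \<Rightarrow> nat) \<Rightarrow> real ^ 'd \<Rightarrow> real ^ 'd" where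
  "monomial_grad \<alpha> = (SOME g. has_cont_grad (monomial \<alpha>) g)"

definition poly_of :: "nat \<Rightarrow> (('d \<Rightarrow> nat) \<Rightarrow> real) \<Rightarrow> real ^ 'd \<Rightarrow> real" where
  "poly_of k c x = (\<Sum>\<alpha>\<in>multi_indices k. c \<alpha> * monomial \<alpha> x)"

definition poly_grad :: "nat \<Rightarrow> (('d \<Rightarrow> nat) \<Rightarrow> real) \<Rightarrow> real ^ 'd \<Rightarrow> real ^ 'd" where
  "poly_grad k c x = (\<Sum>\<alpha>\<in>multi_indices k. c \<alpha> *\<^sub>R monomial_grad \<alpha> x)"

lemma finite_multi_indices: "finite (multi_indices k :: ('d::finite \<Rightarrow> nat) set)"
proof (rule finite_subset)
  show "multi_indices k \<subseteq> PiE (UNIV :: 'd set) (\<lambda>_. {..k})"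
  proof
    fix \<alpha> :: "'d \<Rightarrow> nat" assume "\<alpha> \<in> multi_indices k"
    then have "\<alpha> i \<le> k" for i
      using member_le_sum[of i UNIV \<alpha>] unfolding multi_indices_def by fastforce
    then show "\<alpha> \<in> PiE UNIV (\<lambda>_. {..k})" by auto
  qed
qed (auto intro: finite_PiE)

lemma poly_fun_iff: "poly_fun k p \<longleftrightarrow> (\<exists>c. p = poly_of k c)"
  unfolding poly_fun_def poly_of_def[abs_def] multi_indices_def monomial_def by simp

lemma has_cont_grad_monomial: "has_cont_grad (monomial \<alpha>) (monomial_grad \<alpha>)"
proof -
  have "\<exists>F. has_cont_grad (\<lambda>x. (x $ i) ^ m) F" for i :: 'a and m
  proof -
    have "has_cont_grad (\<lambda>x. x $ i) (\<lambda>x. axis i 1)"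
      using has_cont_grad_affine[of "axis i 1" 0] by (simp add: inner_axis')
    then have "\<exists>F. has_cont_grad (\<lambda>x. \<Prod>j<m. x $ i) F"
      by (intro ex_has_cont_grad_prod) blast
    then show ?thesis by simp
  qed
  then have "\<exists>F. has_cont_grad (monomial \<alpha>) F"
    unfolding monomial_def[abs_def] by (intro ex_has_cont_grad_prod) blast
  then show ?thesis unfolding monomial_grad_def by (rule someI_ex)
qed

lemma has_cont_grad_poly: "has_cont_grad (poly_of k c) (poly_grad k c)"
  unfolding poly_of_def[abs_def] poly_grad_def[abs_def]
  by (intro has_cont_grad_sum has_cont_grad_scale has_cont_grad_monomial)

lemma poly_of_lincomb: "poly_of k (\<lambda>\<alpha>. c \<alpha> + t * d \<alpha>) x = poly_of k c x + t * poly_of k d x"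
  unfolding poly_of_def by (simp add: sum.distrib sum_distrib_left algebra_simps)

lemma poly_grad_lincomb:
  "poly_grad k (\<lambda>\<alpha>. c \<alpha> + t * d \<alpha>) x = poly_grad k c x + t *\<^sub>R poly_grad k d x"
  unfolding poly_grad_def
  by (simp add: sum.distrib scaleR_sum_right scaleR_add_left)

text \<open>Coefficients beyond degree \<open>k\<close> do not count, so that testing with vectors supported on the multi-indices
tests with all polynomials.\<close>

lemma poly_grad_restrict:
  "poly_grad k (\<lambda>\<alpha>. if \<alpha> \<in> multi_indices k then c \<alpha> else 0) = poly_grad k c"
  unfolding poly_grad_def[abs_def] by (intro ext sum.cong) auto

lemma ex_poly_of_add_const:
  fixes c :: "('d::finite \<Rightarrow> nat) \<Rightarrow> real"
  shows "\<exists>d. \<forall>x. poly_of k d x = poly_of k c x + m"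
proof
  define \<delta> :: "('d \<Rightarrow> nat) \<Rightarrow> real" where "\<delta> = (\<lambda>\<alpha>. if \<alpha> = (\<lambda>i. 0) then 1 else 0)"
  have "poly_of k \<delta> x = (\<Sum>\<alpha>\<in>multi_indices k. \<delta> \<alpha>)" for x
    unfolding poly_of_def \<delta>_def monomial_def by (intro sum.cong) auto
  also have "\<dots> = 1"
    unfolding \<delta>_def by (simp add: finite_multi_indices) (simp add: multi_indices_def)
  finally show "\<forall>x. poly_of k (\<lambda>\<alpha>. c \<alpha> + m * \<delta> \<alpha>) x = poly_of k c x + m"
    unfolding poly_of_lincomb by simp
qed

section \<open>The bilinear forms on piecewise polynomials\<close>

lemma AE_in_interior_if_convex:
  fixes T :: "(real ^ 'd) set"
  assumes "convex T"
  shows "AE x in lebesgue. x \<in> T \<longrightarrow> x \<in> interior T"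
proof -
  have "AE x in lebesgue. x \<notin> frontier T"
    by (rule AE_not_in) (use negligible_convex_frontier[OF assms] negligible_iff_null_sets in blast)
  then show ?thesis
    by eventually_elim (use closure_subset in \<open>auto simp: frontier_def\<close>)
qed

text \<open>Only the values of \<open>u\<close> on the interior of \<open>T\<close> are prescribed: this makes the lemma applicable to the
global lifting, which agrees with the local one only there. The boundary of \<open>T\<close> is a null set.\<close>

lemma wgrad_eq_AE:
  assumes T: "convex T" and p: "has_cont_grad p P" and u: "\<And>x. x \<in> interior T \<Longrightarrow> u x = p x"
  shows "AE x in lebesgue. x \<in> T \<longrightarrow> wgrad (interior T) u x = P x"
proof -
  have P: "has_weak_grad (interior T) u P" using has_weak_grad_of_cont_grad[OF p u] .
  then have "has_weak_grad (interior T) u (wgrad (interior T) u)"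
    unfolding wgrad_def by (rule someI[of "has_weak_grad (interior T) u"])
  from weak_grad_unique_AE[OF this P open_interior] AE_in_interior_if_convex[OF T]
  show ?thesis by eventually_elim blast
qed

lemma borel_measurable_lebesgue_cont:
  fixes f :: "real ^ 'd \<Rightarrow> 'b::euclidean_space"
  shows "continuous_on UNIV f \<Longrightarrow> f \<in> borel_measurable lebesgue"
  by (intro measurable_completion) (simp add: borel_measurable_continuous_onI)

lemma set_integral_AE_eq_cont:
  fixes f :: "real ^ 'd \<Rightarrow> 'b::euclidean_space"
  assumes "A \<in> sets lebesgue" "continuous_on UNIV g" and ae: "AE x in lebesgue. x \<in> A \<longrightarrow> f x = g x"
  shows "(LINT x:A|lebesgue. f x) = (LINT x:A|lebesgue. g x)"
proof -
  have g: "(\<lambda>x. indicator A x *\<^sub>R g x) \<in> borel_measurable lebesgue"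
    using assms by (intro borel_measurable_scaleR borel_measurable_indicator borel_measurable_lebesgue_cont)
  have "AE x in lebesgue. indicator A x *\<^sub>R g x = indicator A x *\<^sub>R f x"
    using ae by eventually_elim (auto simp: indicator_def)
  with g borel_measurable_AE[OF g this] show ?thesis
    unfolding set_lebesgue_integral_def by (intro integral_cong_AE) auto
qed

lemma a_loc_eq:
  assumes T: "convex T" "compact T" and p: "has_cont_grad p P" "\<And>x. x \<in> interior T \<Longrightarrow> u x = p x"
    and q: "has_cont_grad q Q" "\<And>x. x \<in> interior T \<Longrightarrow> v x = q x"
  shows "a_loc T u v = (LINT x:T|lebesgue. P x \<bullet> Q x)"
  unfolding a_loc_def
proof (rule set_integral_AE_eq_cont)
  show "T \<in> sets lebesgue" using T by (simp add: compact_imp_closed)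
  show "continuous_on UNIV (\<lambda>x. P x \<bullet> Q x)"
    by (intro continuous_intros has_cont_grad_grad_cont[OF p(1)] has_cont_grad_grad_cont[OF q(1)])
  show "AE x in lebesgue. x \<in> T \<longrightarrow> wgrad (interior T) u x \<bullet> wgrad (interior T) v x = P x \<bullet> Q x"
  proof -
    have "AE x in lebesgue. x \<in> T \<longrightarrow> wgrad (interior T) u x = P x"
      by (rule wgrad_eq_AE[OF T(1) p(1)]) (rule p(2))
    moreover have "AE x in lebesgue. x \<in> T \<longrightarrow> wgrad (interior T) v x = Q x"
      by (rule wgrad_eq_AE[OF T(1) q(1)]) (rule q(2))
    ultimately show ?thesis by eventually_elim auto
  qed
qed

text \<open>A point \<open>y\<close> of a convex body is a limit of interior points, so the pieces \<open>T \<inter> ball y r\<close> have positive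
measure and the averages over them are genuine. The limit does not change if \<open>f\<close> is modified on a null set,
which allows for \<open>f = wgrad (interior T) u\<close>.\<close>

lemma bdry_trace_eq:
  fixes g :: "real ^ 'd \<Rightarrow> 'b::euclidean_space"
  assumes T: "convex T" "compact T" "interior T \<noteq> {}" and y: "y \<in> T"
    and g: "continuous_on UNIV g" and ae: "AE x in lebesgue. x \<in> T \<longrightarrow> f x = g x"
  shows "bdry_trace T f y = g y"
proof -
  let ?D = "\<lambda>r. T \<inter> ball y r"
  have D: "?D r \<in> lmeasurable" for r
    using T by (intro fmeasurable.Int lmeasurable_compact lmeasurable_ball)
  have pos: "measure lebesgue (?D r) > 0" if "r > 0" for r
  proof -
    have "y \<in> closure (interior T)"
      using y T convex_closure_interior[of T] closure_subset by blast
    then have "interior T \<inter> ball y r \<noteq> {}"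
      using that unfolding closure_approachable by (fastforce simp: dist_commute)
    then have "\<not> negligible (interior T \<inter> ball y r)" by (intro open_not_negligible) auto
    then have "\<not> negligible (?D r)"
      by (meson Int_mono interior_subset negligible_subset order_refl)
    then show ?thesis
      using D[of r] negligible_iff_measure0 by (metis zero_less_measure_iff negligible_iff_measure)
  qed
  have "((\<lambda>r. (1 / measure lebesgue (?D r)) *\<^sub>R (LINT x:?D r|lebesgue. f x)) \<longlongrightarrow> g y) (at_right 0)"
  proof (rule tendstoI)
    fix \<epsilon> :: real assume \<epsilon>: "\<epsilon> > 0"
    obtain \<delta> where \<delta>: "\<delta> > 0" "\<And>x. dist x y < \<delta> \<Longrightarrow> dist (g x) (g y) < \<epsilon> / 2"
      using g \<epsilon> unfolding continuous_on_iff by (metis UNIV_I half_gt_zero)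
    have "dist ((1 / measure lebesgue (?D r)) *\<^sub>R (LINT x:?D r|lebesgue. f x)) (g y) < \<epsilon>"
      if r: "0 < r" "r < \<delta>" for r
    proof -
      let ?m = "measure lebesgue (?D r)"
      have "(LINT x:?D r|lebesgue. f x) = (LINT x:?D r|lebesgue. g x)"
        using D ae by (intro set_integral_AE_eq_cont g) (auto elim: eventually_mono)
      have gi: "set_integrable lebesgue (?D r) g"
        by (rule set_integrable_subset[OF set_integrable_lebesgue_compact[OF T(2), of g]])
          (use g D in \<open>auto intro: continuous_on_subset\<close>)
      have ci: "set_integrable lebesgue (?D r) (\<lambda>x. c)" for c :: 'b
        by (rule set_integrable_subset[OF set_integrable_lebesgue_compact[OF T(2)]]) (use D in auto)
      have "norm ((LINT x:?D r|lebesgue. g x) - ?m *\<^sub>R g y) \<le> ?m * (\<epsilon> / 2)"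
      proof -
        have "(LINT x:?D r|lebesgue. g x) - ?m *\<^sub>R g y = (LINT x:?D r|lebesgue. g x - g y)"
        proof -
          have "(LINT x:?D r|lebesgue. g y) = ?m *\<^sub>R g y"
            by (rule set_integral_const) (use D[of r] in \<open>auto simp: fmeasurable_def\<close>)
          then show ?thesis by (subst set_integral_diff(2)[OF gi ci]) simp
        qed
        also have "norm \<dots> \<le> (LINT x:?D r|lebesgue. norm (g x - g y))"
          by (rule set_integral_norm_bound) (use gi ci in auto)
        also have "\<dots> \<le> (LINT x:?D r|lebesgue. \<epsilon> / 2)"
        proof (rule set_integral_mono)
          show "set_integrable lebesgue (?D r) (\<lambda>x. norm (g x - g y))"
            by (intro set_integrable_norm set_integral_diff gi ci)
          show "set_integrable lebesgue (?D r) (\<lambda>x. \<epsilon> / 2)"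
            by (rule set_integrable_subset[OF set_integrable_lebesgue_compact[OF T(2)]]) (use D in auto)
          show "norm (g x - g y) \<le> \<epsilon> / 2" if "x \<in> ?D r" for x
            using \<delta>(2)[of x] that r by (auto simp: dist_norm norm_minus_commute)
        qed
        also have "\<dots> = ?m * (\<epsilon> / 2)"
          using D[of r] by (simp add: set_lebesgue_integral_def)
        finally show ?thesis .
      qed
      then have "norm ((1 / ?m) *\<^sub>R ((LINT x:?D r|lebesgue. g x) - ?m *\<^sub>R g y)) \<le> (1 / ?m) * (?m * (\<epsilon> / 2))"
        unfolding norm_scaleR using pos[OF r(1)] by (intro mult_mono) auto
      then show ?thesis
        unfolding \<open>(LINT x:?D r|lebesgue. f x) = _\<close>
        using pos[OF r(1)] \<epsilon> by (simp add: dist_norm scaleR_diff_right)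
    qed
    then show "\<forall>\<^sub>F r in at_right 0. dist ((1 / measure lebesgue (?D r)) *\<^sub>R (LINT x:?D r|lebesgue. f x)) (g y) < \<epsilon>"
      unfolding eventually_at_right_field using \<delta>(1) by (intro exI[of _ \<delta>]) auto
  qed
  then show ?thesis unfolding bdry_trace_def by (intro tendsto_Lim) auto
qed

text \<open>The prism of height one over a bounded set is bounded: its points are at distance at most
\<open>norm n\<close> from their projections.\<close>

lemma emeasure_facet_measure_finite:
  fixes S :: "(real ^ 'd) set"
  assumes "compact S"
  shows "emeasure (facet_measure T F) S < \<infinity>"
proof -
  obtain n c where nc: "facet_plane T F = (n, c)" by fastforce
  let ?H = "{x. c \<le> n \<bullet> x \<and> n \<bullet> x \<le> c + 1}" and ?\<pi> = "\<lambda>x. x - (n \<bullet> x - c) *\<^sub>R n"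
  have H: "?H \<in> sets borel" by (intro borel_closed closed_Collect_conj closed_Collect_le continuous_intros)
  have \<pi>: "?\<pi> \<in> measurable (restrict_space lborel ?H) borel"
    by (intro measurable_restrict_space1) (auto intro!: borel_measurable_continuous_onI continuous_intros)
  have "emeasure (facet_measure T F) S = emeasure (restrict_space lborel ?H) (?\<pi> -` S \<inter> space (restrict_space lborel ?H))"
    unfolding facet_measure_def nc plane_measure_def
    by (simp add: emeasure_distr[OF \<pi>] assms borel_compact)
  also have "\<dots> = emeasure lborel (?\<pi> -` S \<inter> space (restrict_space lborel ?H))"
    using H by (intro emeasure_restrict_space) (auto simp: space_restrict_space)
  also have "\<dots> < \<infinity>"
  proof (rule emeasure_bounded_finite)
    obtain R where R: "\<And>x. x \<in> S \<Longrightarrow> norm x \<le> R"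
      using compact_imp_bounded[OF assms] unfolding bounded_iff by blast
    show "bounded (?\<pi> -` S \<inter> space (restrict_space lborel ?H))"
      unfolding bounded_iff
    proof (intro exI ballI)
      fix x assume x: "x \<in> ?\<pi> -` S \<inter> space (restrict_space lborel ?H)"
      then have "norm (?\<pi> x) \<le> R" "\<bar>n \<bullet> x - c\<bar> \<le> 1" using R by (auto simp: space_restrict_space)
      moreover have "norm x \<le> norm (?\<pi> x) + norm ((n \<bullet> x - c) *\<^sub>R n)"
        using norm_triangle_ineq[of "?\<pi> x" "(n \<bullet> x - c) *\<^sub>R n"] by simp
      moreover have "norm ((n \<bullet> x - c) *\<^sub>R n) \<le> norm n"
        using \<open>\<bar>n \<bullet> x - c\<bar> \<le> 1\<close> by (simp add: mult_left_le_one_le)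
      ultimately show "norm x \<le> R + norm n" by linarith
    qed
  qed
  finally show ?thesis .
qed

lemma sets_facet_measure: "sets (facet_measure T F) = sets borel"
  by (auto simp: facet_measure_def plane_measure_def split: prod.split)

lemma set_integrable_facet:
  fixes f :: "real ^ 'd \<Rightarrow> real"
  assumes S: "compact S" and f: "continuous_on UNIV f"
  shows "set_integrable (facet_measure T F) S f"
proof -
  obtain M where M: "\<And>x. x \<in> S \<Longrightarrow> norm (f x) \<le> M"
    using compact_imp_bounded[OF compact_continuous_image[OF continuous_on_subset[OF f] S]]
    unfolding bounded_iff by (metis image_eqI subset_UNIV)
  have SS: "S \<in> sets (facet_measure T F)" using S by (simp add: sets_facet_measure borel_compact)
  have fm: "f \<in> borel_measurable (facet_measure T F)"
    using borel_measurable_continuous_onI[OF f] by (simp cong: measurable_cong_sets add: sets_facet_measure)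
  show ?thesis unfolding set_integrable_def
  proof (rule Bochner_Integration.integrable_bound)
    show "integrable (facet_measure T F) (\<lambda>x. indicator S x *\<^sub>R M)"
      using SS emeasure_facet_measure_finite[OF S, of T F] by (intro integrable_indicator)
    show "(\<lambda>x. indicator S x *\<^sub>R f x) \<in> borel_measurable (facet_measure T F)"
      using SS fm by (intro borel_measurable_scaleR borel_measurable_indicator)
    show "AE x in facet_measure T F. norm (indicator S x *\<^sub>R f x) \<le> norm (indicator S x *\<^sub>R M)"
      using M by (intro AE_I2) (fastforce simp: indicator_def)
  qed
qed

lemma Nc_loc_eq:
  assumes T: "convex T" "compact T" "interior T \<noteq> {}"
    and p: "has_cont_grad p P" "\<And>x. x \<in> interior T \<Longrightarrow> u x = p x"
    and q: "continuous_on UNIV q" "\<And>x. x \<in> T \<Longrightarrow> v x = q x"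
  shows "Nc_loc \<Omega> T u v =
    (\<Sum>F | F facet_of T. LINT y:frontier \<Omega> \<inter> F|facet_measure T F. - (P y \<bullet> outer_normal T F) * q y)"
  unfolding Nc_loc_def
proof (rule sum.cong[OF refl])
  fix F assume "F \<in> {F. F facet_of T}"
  then have FT: "F \<subseteq> T" by (simp add: facet_of_imp_subset)
  have "bdry_trace T (wgrad (interior T) u) y = P y" "bdry_trace T v y = q y" if "y \<in> F" for y
    using that FT p q
    by (auto intro!: bdry_trace_eq[OF T] wgrad_eq_AE[OF T(1)] has_cont_grad_grad_cont[OF p(1)])
  then show "(LINT y:frontier \<Omega> \<inter> F|facet_measure T F. - normal_deriv T F u y * bdry_trace T v y) =
    (LINT y:frontier \<Omega> \<inter> F|facet_measure T F. - (P y \<bullet> outer_normal T F) * q y)"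
    unfolding normal_deriv_def set_lebesgue_integral_def
    by (intro Bochner_Integration.integral_cong) (auto simp: indicator_def)
qed

text \<open>The energy form and the boundary functional \<open>v \<mapsto> Nc_loc \<Omega> T v q\<close> in terms of the coefficients of
the polynomials.\<close>

definition poly_energy :: "nat \<Rightarrow> (real ^ 'd) set \<Rightarrow> (('d \<Rightarrow> nat) \<Rightarrow> real) \<Rightarrow> (('d \<Rightarrow> nat) \<Rightarrow> real) \<Rightarrow> real" where
  "poly_energy k T c d = (LINT x:T|lebesgue. poly_grad k c x \<bullet> poly_grad k d x)"

definition poly_flux ::
  "(real ^ 'd) set \<Rightarrow> nat \<Rightarrow> (real ^ 'd) set \<Rightarrow> (real ^ 'd \<Rightarrow> real) \<Rightarrow> (('d \<Rightarrow> nat) \<Rightarrow> real) \<Rightarrow> real" where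
  "poly_flux \<Omega> k T q c = (\<Sum>F | F facet_of T.
     LINT y:frontier \<Omega> \<inter> F|facet_measure T F. - (poly_grad k c y \<bullet> outer_normal T F) * q y)"

lemma continuous_on_poly_grad: "continuous_on A (poly_grad k c)"
  by (rule has_cont_grad_grad_cont[OF has_cont_grad_poly])

lemma continuous_on_poly: "continuous_on A (poly_of k c)"
  by (rule has_cont_grad_cont[OF has_cont_grad_poly])

lemma poly_energy_sym: "poly_energy k T c d = poly_energy k T d c"
  unfolding poly_energy_def by (simp add: inner_commute)

lemma poly_energy_nonneg: "0 \<le> poly_energy k T c c"
  unfolding poly_energy_def set_lebesgue_integral_def by (intro integral_nonneg_AE) simp

lemma poly_energy_lincomb:
  assumes "compact T"
  shows "poly_energy k T (\<lambda>\<alpha>. c \<alpha> + t * d \<alpha>) e = poly_energy k T c e + t * poly_energy k T d e"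
proof -
  have "set_integrable lebesgue T (\<lambda>x. poly_grad k c x \<bullet> poly_grad k e x)" for c
    by (intro set_integrable_lebesgue_compact assms continuous_intros continuous_on_poly_grad)
  then show ?thesis
    unfolding poly_energy_def poly_grad_lincomb inner_add_left inner_scaleR_left
    by (subst set_integral_add) auto
qed

text \<open>The gradient vanishes almost everywhere in \<open>T\<close>; being continuous, it vanishes everywhere in the
interior, and then also on the boundary, where it is needed for \<open>poly_flux_eq_0\<close>.\<close>

lemma poly_energy_null_imp_grad_0:
  assumes T: "convex T" "compact T" "interior T \<noteq> {}"
    and null: "poly_energy k T c c = 0" and y: "y \<in> T"
  shows "poly_grad k c y = 0"
proof -
  have int: "set_integrable lebesgue T (\<lambda>x. poly_grad k c x \<bullet> poly_grad k c x)"
    by (intro set_integrable_lebesgue_compact T continuous_intros continuous_on_poly_grad)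
  have "AE x in lebesgue. indicator T x *\<^sub>R (poly_grad k c x \<bullet> poly_grad k c x) = 0"
    using null integral_nonneg_eq_0_iff_AE[OF int[unfolded set_integrable_def]]
    unfolding poly_energy_def set_lebesgue_integral_def by simp
  then have ae: "AE x \<in> interior T in lebesgue. x \<in> {x. poly_grad k c x = 0}"
    by eventually_elim (use interior_subset[of T] in \<open>auto simp: indicator_def split: if_splits\<close>)
  have closed: "closed {x. poly_grad k c x = 0}"
    by (intro closed_Collect_eq continuous_on_poly_grad continuous_on_const)
  have "interior T \<subseteq> {x. poly_grad k c x = 0}"
    using mem_closed_if_AE_lebesgue_open[OF open_interior closed ae] by blast
  then have "closure (interior T) \<subseteq> {x. poly_grad k c x = 0}" using closed by (rule closure_minimal)
  then show ?thesis using y convex_closure_interior[OF T(1,3)] closure_subset[of T] by blast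
qed

lemma compact_boundary_part:
  assumes "convex T" "compact T" "F facet_of T"
  shows "compact (frontier \<Omega> \<inter> F)"
  using face_of_imp_compact[OF assms(1,2) facet_of_imp_face_of[OF assms(3)]]
  by (intro closed_Int_compact) auto

lemma poly_flux_lincomb:
  assumes T: "convex T" "compact T" and q: "continuous_on UNIV q"
  shows "poly_flux \<Omega> k T q (\<lambda>\<alpha>. c \<alpha> + t * d \<alpha>) = poly_flux \<Omega> k T q c + t * poly_flux \<Omega> k T q d"
proof -
  have int: "set_integrable (facet_measure T F) (frontier \<Omega> \<inter> F)
      (\<lambda>y. - (poly_grad k c y \<bullet> outer_normal T F) * q y)" if "F facet_of T" for F c
    by (intro set_integrable_facet compact_boundary_part[OF T that] continuous_intros
        continuous_on_poly_grad q)
  have "(LINT y:frontier \<Omega> \<inter> F|facet_measure T F.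
          - (poly_grad k (\<lambda>\<alpha>. c \<alpha> + t * d \<alpha>) y \<bullet> outer_normal T F) * q y)
      = (LINT y:frontier \<Omega> \<inter> F|facet_measure T F. - (poly_grad k c y \<bullet> outer_normal T F) * q y)
        + t * (LINT y:frontier \<Omega> \<inter> F|facet_measure T F. - (poly_grad k d y \<bullet> outer_normal T F) * q y)"
    if F: "F facet_of T" for F
  proof -
    have "- (poly_grad k (\<lambda>\<alpha>. c \<alpha> + t * d \<alpha>) y \<bullet> outer_normal T F) * q y
        = - (poly_grad k c y \<bullet> outer_normal T F) * q y
          + t * (- (poly_grad k d y \<bullet> outer_normal T F) * q y)" for y
      unfolding poly_grad_lincomb by (simp add: inner_add_left algebra_simps)
    then show ?thesis
      by (simp only: set_integral_add(2)[OF int[OF F] set_integrable_mult_right[OF int[OF F]]]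
          set_integral_mult_right)
  qed
  then show ?thesis
    unfolding poly_flux_def by (simp add: sum.distrib sum_distrib_left)
qed

lemma poly_flux_eq_0:
  assumes T: "convex T" "compact T" "interior T \<noteq> {}" and null: "poly_energy k T c c = 0"
  shows "poly_flux \<Omega> k T q c = 0"
  unfolding poly_flux_def set_lebesgue_integral_def
proof (intro sum.neutral ballI integral_eq_zero_AE AE_I2)
  fix F y assume "F \<in> {F. F facet_of T}"
  then have "y \<in> F \<Longrightarrow> poly_grad k c y = 0"
    using poly_energy_null_imp_grad_0[OF T null] facet_of_imp_subset by blast
  then show "indicator (frontier \<Omega> \<inter> F) y *\<^sub>R (- (poly_grad k c y \<bullet> outer_normal T F) * q y) = 0"
    by (auto simp: indicator_def)
qed

section \<open>The lifting\<close>

lemma Pk_iff: "u \<in> Pk k T \<longleftrightarrow> (\<exists>c. \<forall>x\<in>T. u x = poly_of k c x)"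
  unfolding Pk_def poly_fun_iff by auto

text \<open>Here \<open>m\<close> is the mean value of the polynomial over \<open>T\<close>.\<close>

lemma ex_poly_minus_mean_in_Pk0:
  assumes T: "compact T" "interior T \<noteq> {}"
  shows "\<exists>m. (\<lambda>x. poly_of k c x - m) \<in> Pk0 k T"
proof -
  have m: "T \<in> sets lebesgue" "emeasure lebesgue T \<noteq> \<infinity>"
    using lmeasurable_compact[OF T(1)] by (auto simp: fmeasurable_def)
  have "\<not> negligible T"
    using T(2) open_not_negligible[OF open_interior] negligible_subset interior_subset by blast
  then have pos: "measure lebesgue T \<noteq> 0"
    using lmeasurable_compact[OF T(1)] negligible_iff_measure by blast
  define \<mu> where "\<mu> = (LINT x:T|lebesgue. poly_of k c x) / measure lebesgue T"
  obtain d where d: "\<And>x. poly_of k d x = poly_of k c x + (- \<mu>)"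
    using ex_poly_of_add_const by blast
  have "(LINT x:T|lebesgue. poly_of k c x - \<mu>) = 0"
  proof -
    have "set_integrable lebesgue T (poly_of k c)" "set_integrable lebesgue T (\<lambda>x. \<mu>)"
      by (intro set_integrable_lebesgue_compact T continuous_on_poly continuous_on_const)+
    then have "(LINT x:T|lebesgue. poly_of k c x - \<mu>) = (LINT x:T|lebesgue. poly_of k c x) - (LINT x:T|lebesgue. \<mu>)"
      by (rule set_integral_diff(2))
    also have "\<dots> = 0" using set_integral_const[OF m, of \<mu>] pos by (simp add: \<mu>_def)
    finally show ?thesis .
  qed
  then have "(\<lambda>x. poly_of k c x - \<mu>) \<in> Pk0 k T"
    unfolding Pk0_def Pk_iff using d by (auto intro!: exI[of _ d])
  then show ?thesis by blast
qed

lemma has_cont_grad_poly_minus_const: "has_cont_grad (\<lambda>x. poly_of k c x - m) (poly_grad k c)"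
  using has_cont_grad_add[OF has_cont_grad_poly has_cont_grad_const[of "- m"]] by simp

text \<open>The Riesz lemma is applied in the space of all polynomials of degree at most \<open>k\<close>; the mean of the
resulting polynomial is then subtracted, which leaves its gradient unchanged.\<close>

lemma lift_loc_spec:
  assumes T: "convex T" "compact T" "interior T \<noteq> {}" and bdry: "boundary_element \<Omega> T"
    and q: "continuous_on UNIV q" "\<And>x. x \<in> T \<Longrightarrow> u x = q x"
  shows "lift_loc \<Omega> k T u \<in> Pk0 k T"
    and "\<And>v. v \<in> Pk0 k T \<Longrightarrow> a_loc T (lift_loc \<Omega> k T u) v = Nc_loc \<Omega> T v u"
proof -
  obtain c where c: "\<And>d. (\<forall>\<alpha>. \<alpha> \<notin> multi_indices k \<longrightarrow> d \<alpha> = 0) \<Longrightarrow> poly_energy k T c d = poly_flux \<Omega> k T q d"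
    using semidefinite_riesz[OF finite_multi_indices, where B = "poly_energy k T" and l = "poly_flux \<Omega> k T q",
        OF poly_energy_lincomb poly_energy_sym poly_energy_nonneg poly_flux_lincomb poly_flux_eq_0,
        OF T(2) T(1,2) q(1) T] by blast
  have c': "poly_energy k T c d = poly_flux \<Omega> k T q d" for d
    using c[of "\<lambda>\<alpha>. if \<alpha> \<in> multi_indices k then d \<alpha> else 0"]
    by (simp add: poly_energy_def poly_flux_def poly_grad_restrict)
  obtain m where m: "(\<lambda>x. poly_of k c x - m) \<in> Pk0 k T"
    using ex_poly_minus_mean_in_Pk0 T by blast
  have "a_loc T (\<lambda>x. poly_of k c x - m) v = Nc_loc \<Omega> T v u" if v: "v \<in> Pk0 k T" for v
  proof -
    obtain d where d: "\<And>x. x \<in> T \<Longrightarrow> v x = poly_of k d x"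
      using v unfolding Pk0_def Pk_iff by blast
    have di: "v x = poly_of k d x" if "x \<in> interior T" for x
      using d that interior_subset by blast
    have "a_loc T (\<lambda>x. poly_of k c x - m) v = poly_energy k T c d"
      unfolding poly_energy_def
      by (rule a_loc_eq[OF T(1,2) has_cont_grad_poly_minus_const _ has_cont_grad_poly di]) auto
    also have "\<dots> = Nc_loc \<Omega> T v u"
      unfolding c' poly_flux_def by (rule Nc_loc_eq[OF T has_cont_grad_poly di q, symmetric])
    finally show ?thesis .
  qed
  with m have "\<exists>w. w \<in> Pk0 k T \<and> (\<forall>v\<in>Pk0 k T. a_loc T w v = Nc_loc \<Omega> T v u)" by blast
  from someI_ex[OF this] bdry
  show "lift_loc \<Omega> k T u \<in> Pk0 k T"
    and "\<And>v. v \<in> Pk0 k T \<Longrightarrow> a_loc T (lift_loc \<Omega> k T u) v = Nc_loc \<Omega> T v u"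
    unfolding lift_loc_def by auto
qed

lemma Nc_loc_interior_element:
  assumes T: "convex T" "compact T" and "\<not> boundary_element \<Omega> T"
  shows "Nc_loc \<Omega> T u v = 0"
  unfolding Nc_loc_def set_lebesgue_integral_def
proof (intro sum.neutral ballI integral_eq_zero_AE)
  fix F assume "F \<in> {F. F facet_of T}"
  then have F: "F facet_of T" by simp
  have "frontier \<Omega> \<inter> F \<in> sets (facet_measure T F)"
    using compact_boundary_part[OF T F] by (simp add: sets_facet_measure borel_compact)
  moreover have "emeasure (facet_measure T F) (frontier \<Omega> \<inter> F) = 0"
    using assms(3) F unfolding boundary_element_def by (meson not_gr_zero)
  ultimately have "frontier \<Omega> \<inter> F \<in> null_sets (facet_measure T F)" by (intro null_setsI)
  then have "AE y in facet_measure T F. y \<notin> frontier \<Omega> \<inter> F" by (rule AE_not_in)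
  then show "AE y in facet_measure T F. indicator (frontier \<Omega> \<inter> F) y *\<^sub>R
      (- normal_deriv T F u y * bdry_trace T v y) = 0"
    by eventually_elim (simp add: indicator_def)
qed

lemma a_loc_nonneg: "0 \<le> a_loc T u u"
  unfolding a_loc_def set_lebesgue_integral_def by (intro integral_nonneg_AE) simp

text \<open>With \<open>b\<close> and \<open>c\<close> the coefficients of the lifting and of \<open>u\<close>, the difference of the two sides is one
half of the energy of \<open>c + 2 b\<close>. The function \<open>w\<close> stands for the restriction of the global lifting.\<close>

lemma element_coercivity:
  assumes T: "convex T" "compact T" "interior T \<noteq> {}" and u: "u \<in> Pk k T"
    and w: "\<And>x. x \<in> interior T \<Longrightarrow> w x = lift_loc \<Omega> k T u x"
  shows "1 / 2 * a_loc T u u \<le> a_loc T u u + 2 * Nc_loc \<Omega> T u u + 2 * a_loc T w w"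
proof (cases "boundary_element \<Omega> T")
  case False
  then show ?thesis using Nc_loc_interior_element[OF T(1,2)] a_loc_nonneg[of T u] a_loc_nonneg[of T w] by simp
next
  case True
  note int = interior_subset[THEN subsetD]
  obtain c where c: "\<And>x. x \<in> T \<Longrightarrow> u x = poly_of k c x" using u unfolding Pk_iff by blast
  have "lift_loc \<Omega> k T u \<in> Pk0 k T" by (rule lift_loc_spec(1)[OF T True continuous_on_poly c])
  then obtain b where b: "\<And>x. x \<in> T \<Longrightarrow> lift_loc \<Omega> k T u x = poly_of k b x"
    unfolding Pk0_def Pk_iff by blast
  obtain m where v: "(\<lambda>x. poly_of k c x - m) \<in> Pk0 k T" using ex_poly_minus_mean_in_Pk0 T by blast
  have "a_loc T u u = poly_energy k T c c"
    unfolding poly_energy_def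
    by (rule a_loc_eq[OF T(1,2) has_cont_grad_poly _ has_cont_grad_poly]) (use c int in auto)
  moreover have "a_loc T w w = poly_energy k T b b"
    unfolding poly_energy_def
    by (rule a_loc_eq[OF T(1,2) has_cont_grad_poly _ has_cont_grad_poly]) (use w b int in auto)
  \<comment> \<open>Subtracting the mean makes \<open>u\<close> an admissible test function for the lifting.\<close>
  moreover have "Nc_loc \<Omega> T u u = poly_energy k T b c"
  proof -
    have "Nc_loc \<Omega> T u u = poly_flux \<Omega> k T (poly_of k c) c"
      unfolding poly_flux_def
      by (rule Nc_loc_eq[OF T has_cont_grad_poly _ continuous_on_poly c]) (use c int in auto)
    also have "\<dots> = Nc_loc \<Omega> T (\<lambda>x. poly_of k c x - m) u"
      unfolding poly_flux_def
      by (rule Nc_loc_eq[OF T has_cont_grad_poly_minus_const _ continuous_on_poly c, symmetric]) auto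
    also have "\<dots> = a_loc T (lift_loc \<Omega> k T u) (\<lambda>x. poly_of k c x - m)"
      by (rule lift_loc_spec(2)[OF T True continuous_on_poly c v, symmetric])
    also have "\<dots> = poly_energy k T b c"
      unfolding poly_energy_def
      by (rule a_loc_eq[OF T(1,2) has_cont_grad_poly _ has_cont_grad_poly_minus_const]) (use b int in auto)
    finally show ?thesis .
  qed
  moreover have "0 \<le> poly_energy k T c c + 4 * poly_energy k T b c + 4 * poly_energy k T b b"
  proof -
    note lin = poly_energy_lincomb[OF T(2), of k c 2 b]
    have "0 \<le> poly_energy k T (\<lambda>\<alpha>. c \<alpha> + 2 * b \<alpha>) (\<lambda>\<alpha>. c \<alpha> + 2 * b \<alpha>)" by (rule poly_energy_nonneg)
    also have "\<dots> = poly_energy k T c c + 4 * poly_energy k T b c + 4 * poly_energy k T b b"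
      unfolding lin poly_energy_sym[of k T c "\<lambda>\<alpha>. c \<alpha> + 2 * b \<alpha>"] poly_energy_sym[of k T b "\<lambda>\<alpha>. c \<alpha> + 2 * b \<alpha>"]
      by (simp add: poly_energy_sym[of k T c b])
    finally show ?thesis .
  qed
  ultimately show ?thesis by simp
qed

section \<open>From elements to the mesh\<close>

lemma simplex_convex_body:
  fixes T :: "(real ^ 'd) set"
  assumes "int CARD('d) simplex T"
  shows "convex T" "compact T" "interior T \<noteq> {}"
proof -
  show "convex T" "compact T"
    using simplex_imp_polytope[OF assms] polytope_imp_convex polytope_imp_compact by auto
  have dim: "aff_dim T = int CARD('d)" using aff_dim_simplex[OF assms] .
  then have "T \<noteq> {}" by auto
  then show "interior T \<noteq> {}"
    using dim \<open>convex T\<close> by (simp add: interior_rel_interior_gen rel_interior_eq_empty)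
qed

lemma triangulation_disjoint_interiors:
  assumes tri: "triangulation \<T>" and "T \<in> \<T>" "S \<in> \<T>" "S \<noteq> T"
  shows "interior S \<inter> interior T = {}"
proof -
  have f: "T \<inter> S face_of T" "S \<inter> T face_of S"
    using tri assms(2,3) unfolding triangulation_def by blast+
  show ?thesis
  proof (cases "T \<inter> S = T")
    case False
    then show ?thesis using face_of_disjoint_interior[OF f(1)] interior_subset[of S] interior_subset[of T] by blast
  next
    case True
    then have "S \<inter> T \<noteq> S" using \<open>S \<noteq> T\<close> by blast
    then show ?thesis using face_of_disjoint_interior[OF f(2)] interior_subset[of S] interior_subset[of T] by blast
  qed
qed

lemma lifting_on_interior:
  assumes "triangulation \<T>" "T \<in> \<T>" "x \<in> interior T"
  shows "lifting \<Omega> \<T> k u x = lift_loc \<Omega> k T u x"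
proof -
  have "finite \<T>" using assms(1) unfolding triangulation_def by blast
  have "(\<Sum>S\<in>\<T> - {T}. indicator (interior S) x * lift_loc \<Omega> k S u x) = 0"
    using triangulation_disjoint_interiors[OF assms(1,2)] assms(3)
    by (intro sum.neutral) (auto simp: indicator_def)
  then show ?thesis
    unfolding lifting_def using assms(3) by (simp add: sum.remove[OF \<open>finite \<T>\<close> assms(2)])
qed

text \<open>The form \<open>A_nn\<close> is given by its formula only on this larger space; the zero function is the regular
summand.\<close>

lemma fe_space_subset_Vreg_plus_Vh: "fe_space \<Omega> \<T> k \<subseteq> Vreg_plus_Vh \<Omega> \<T> k"
proof
  fix u assume u: "u \<in> fe_space \<Omega> \<T> k"
  have L2: "L2_on \<Omega> (\<lambda>x. 0 :: real)" "L2_on \<Omega> (\<lambda>x. 0 :: real ^ 'a)"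
    by (simp_all add: L2_on_def set_borel_measurable_def set_integrable_def)
  have wg: "has_weak_grad \<Omega> (\<lambda>x. 0) (\<lambda>x. 0)"
    by (rule has_weak_grad_of_cont_grad[OF has_cont_grad_const[of 0]]) simp
  have "(\<lambda>x. 0) \<in> H1 \<Omega>" unfolding H1_def using L2 wg by blast
  then have "(\<lambda>x. 0) \<in> H2 \<Omega>" unfolding H2_def using L2 wg by (auto intro!: exI[of _ "\<lambda>x. 0"])
  then show "u \<in> Vreg_plus_Vh \<Omega> \<T> k"
    unfolding Vreg_plus_Vh_def using u by (intro CollectI exI[of _ "\<lambda>x. 0"] exI[of _ u]) auto
qed

theorem lemma2:
  fixes \<Omega> :: "(real ^ 'd) set" and \<T> :: "(real ^ 'd) set set"
    and k :: nat and h \<sigma> C :: real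
  assumes "polyhedral_domain \<Omega>"
    and "fitted_triangulation \<Omega> \<T>"
    and "h > 0"
    and "shape_regular \<sigma> \<T>"
    and "quasi_uniform C h \<T>"
    and "k \<ge> 1"
  shows "(\<forall>u\<in>fe_space \<Omega> \<T> k. A_nn \<Omega> \<T> k u u \<ge> 0) \<and>
         (\<forall>u\<in>fe_space \<Omega> \<T> k. A_nn \<Omega> \<T> k u u \<ge> 1 / 2 * a_form \<T> u u)"
proof -
  have tri: "triangulation \<T>" and simplex: "\<And>T. T \<in> \<T> \<Longrightarrow> int CARD('d) simplex T"
    using assms(2) unfolding fitted_triangulation_def by auto
  have coercive: "1 / 2 * a_form \<T> u u \<le> A_nn \<Omega> \<T> k u u" if u: "u \<in> fe_space \<Omega> \<T> k" for u
  proof -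
    let ?w = "lifting \<Omega> \<T> k u"
    have "u \<in> Vreg_plus_Vh \<Omega> \<T> k" using u fe_space_subset_Vreg_plus_Vh by blast
    then have "A_nn \<Omega> \<T> k u u = a_form \<T> u u + 2 * Nc_form \<Omega> \<T> u u + 2 * a_form \<T> ?w ?w"
      unfolding A_nn_def by simp
    also have "\<dots> = (\<Sum>T\<in>\<T>. a_loc T u u + 2 * Nc_loc \<Omega> T u u + 2 * a_loc T ?w ?w)"
      unfolding a_form_def Nc_form_def by (simp add: sum.distrib sum_distrib_left)
    also have "\<dots> \<ge> (\<Sum>T\<in>\<T>. 1 / 2 * a_loc T u u)"
    proof (rule sum_mono)
      fix T assume T: "T \<in> \<T>"
      have "u \<in> Pk k T" using u T unfolding fe_space_def by blast
      then show "1 / 2 * a_loc T u u \<le> a_loc T u u + 2 * Nc_loc \<Omega> T u u + 2 * a_loc T ?w ?w"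
        using simplex_convex_body[OF simplex[OF T]] lifting_on_interior[OF tri T]
        by (intro element_coercivity)
    qed
    finally show ?thesis unfolding a_form_def by (simp add: sum_distrib_left)
  qed
  moreover have "0 \<le> a_form \<T> u u" for u
    unfolding a_form_def by (intro sum_nonneg a_loc_nonneg)
  ultimately show ?thesis by (smt (verit) mult_nonneg_nonneg zero_le_divide_1_iff)
qed

end
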